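(* Let $3/4<\alpha<1$, and let $\phi_1,\dots,\phi_s\in L^1(X,\Sigma,m)$ be the (finitely many) functions $\phi$ such that $\phi\cdot m$ is an ergodic $T$-invariant probability measure, where $T:X\to X$ is the factor map of $G=G_\alpha$ described in the context. Then there exist $G$-invariant measures $\mu_1,\mu_2,\dots,\mu_s$ on $[0,1]^2$ such that $\pi_*(\mu_i)=\phi_i\cdot m$ for $i=1,2,\dots,s$.
   Context: Let $\tau(x)=1-2|x-1/2|$ on $[0,1]$ and $G=G_\alpha:[0,1]^2\to[0,1]^2$, $G(x,y)=(y,\tau(\alpha y+(1-\alpha)x))$. Let $A_1=\{(x,y)\in[0,1]^2:\alpha y+(1-\alpha)x\le1/2\}$, $A_2=\{(x,y)\in[0,1]^2:\alpha y+(1-\alpha)x\ge1/2\}$, and let $\mathcal P=\{A_1,A_2\}$ (a partition up to the negligible overlap). Let $\mathcal P^-=\bigvee_{n=0}^\infty G^{-n}(\mathcal P)$; its elements are segments or points. For $p\in[0,1]^2$ let $\xi(p)$ be the element of $\mathcal P^-$ containing $p$ and $D(p)=|\xi(p)|$ its length. Let $X=[0,1]^2/\mathcal P^-$ with natural projection $\pi$ and quotient $\sigma$-algebra $\Sigma$, and let $T:X\to X$ be the factor map, $T\circ\pi=\pi\circ G$. $D$ is also regarded as a function on $X$. Let $\bar\nu$ be Lebesgue measure on $[0,1]^2$, $\bar m=\pi_*\bar\nu$, and $m=\frac1D\bar m$ (a finite measure). The functions $\phi_i$ are those of the following fact: the range of the projection $Q$, $Qf=\lim_n\frac1n\sum_{k=0}^{n-1}P_T^kf$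 (limit in $L^1(m)$, with $P_Tf=\frac{d(T_*(fm))}{dm}$), is finite dimensional and is spanned by non-negative functions $\phi_1,\dots,\phi_s$ with $\phi_i\wedge\phi_j=0$ for $i\ne j$, $\int\phi_i\,dm=1$, and these are exactly the $\phi\in L^1(X,\Sigma,m)$ for which $\phi\cdot m$ is a $T$-invariant ergodic probability measure. *)

theory Defs
  imports "HOL-Probability.Probability"
begin

definition tent :: "real \<Rightarrow> real" where
  "tent x = 1 - 2 * \<bar>x - 1/2\<bar>"

definition unit_square :: "(real \<times> real) set" where
  "unit_square = {0..1} \<times> {0..1}"

definition G_map :: "real \<Rightarrow> real \<times> real \<Rightarrow> real \<times> real" where
  "G_map \<alpha> = (\<lambda>(x, y). (y, tent (\<alpha> * y + (1 - \<alpha>) * x)))"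

definition A1 :: "real \<Rightarrow> (real \<times> real) set" where
  "A1 \<alpha> = {(x, y) \<in> unit_square. \<alpha> * y + (1 - \<alpha>) * x \<le> 1/2}"

definition A2 :: "real \<Rightarrow> (real \<times> real) set" where
  "A2 \<alpha> = {(x, y) \<in> unit_square. \<alpha> * y + (1 - \<alpha>) * x \<ge> 1/2}"

text \<open>The closed sets \<open>A1\<close> and \<open>A2\<close> overlap in the segment \<open>\<alpha> y + (1 - \<alpha>) x = 1/2\<close>. To obtain a genuine
  partition the overlap is assigned to \<open>A1\<close>. For \<open>\<alpha> < 1\<close> this changes the elements of the join below
  only along the countably many preimages of that segment, a Lebesgue null set; an element that meets
  the complement of this null set loses at most its endpoints, so its length is unaffected.\<close>

definition partition_P :: "real \<Rightarrow> (real \<times> real) set set" where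
  "partition_P \<alpha> = {A1 \<alpha>, A2 \<alpha> - A1 \<alpha>}"

definition partition_P_minus :: "real \<Rightarrow> (real \<times> real) set set" where
  "partition_P_minus \<alpha> =
     {C. C \<noteq> {} \<and> (\<exists>B :: nat \<Rightarrow> (real \<times> real) set. (\<forall>n. B n \<in> partition_P \<alpha>) \<and>
            C = {p \<in> unit_square. \<forall>n. (G_map \<alpha> ^^ n) p \<in> B n})}"

text \<open>The quotient of the square by the join is the set of its elements, so \<open>proj \<alpha> p\<close> is both the
  element containing \<open>p\<close> and the image of \<open>p\<close> under the natural projection.\<close>

definition proj :: "real \<Rightarrow> real \<times> real \<Rightarrow> (real \<times> real) set" where
  "proj \<alpha> p = (THE C. C \<in> partition_P_minus \<alpha> \<and> p \<in> C)"

definition factor_map :: "real \<Rightarrow> (real \<times> real) set \<Rightarrow> (real \<times> real) set" where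
  "factor_map \<alpha> C = proj \<alpha> (G_map \<alpha> (SOME p. p \<in> C))"

text \<open>The quotient \<open>\<sigma>\<close>-algebra is the largest one making \<open>proj \<alpha>\<close> Borel measurable. Here \<open>quotient_space\<close>
  only serves as the carrier of this \<open>\<sigma>\<close>-algebra; its measure is irrelevant.\<close>

definition quotient_space :: "real \<Rightarrow> (real \<times> real) set measure" where
  "quotient_space \<alpha> = sigma (partition_P_minus \<alpha>)
     {A. A \<subseteq> partition_P_minus \<alpha> \<and> proj \<alpha> -` A \<inter> unit_square \<in> sets borel}"

definition m_bar :: "real \<Rightarrow> (real \<times> real) set measure" where
  "m_bar \<alpha> = distr (restrict_space lborel unit_square) (quotient_space \<alpha>) (proj \<alpha>)"

text \<open>For \<open>3/4 < \<alpha> < 1\<close> the points of the quotient are segments or single points of the square, whose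
  length is their diameter.
  Division is that of \<^typ>\<open>ennreal\<close>, so \<open>1 / 0 = \<infinity>\<close>.\<close>

definition m_D :: "real \<Rightarrow> (real \<times> real) set measure" where
  "m_D \<alpha> = density (m_bar \<alpha>) (\<lambda>C. 1 / ennreal (diameter C))"

definition invariant_measure :: "('a \<Rightarrow> 'a) \<Rightarrow> 'a measure \<Rightarrow> bool" where
  "invariant_measure f M \<longleftrightarrow> f \<in> M \<rightarrow>\<^sub>M M \<and> distr M M f = M"

definition ergodic_probability :: "('a \<Rightarrow> 'a) \<Rightarrow> 'a measure \<Rightarrow> bool" where
  "ergodic_probability f M \<longleftrightarrow> prob_space M \<and> invariant_measure f M \<and>
     (\<forall>A \<in> sets M. f -` A \<inter> space M = A \<longrightarrow> measure M A = 0 \<or> measure M A = 1)"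

text \<open>Non-negativity has to be required explicitly because \<^const>\<open>ennreal\<close> truncates negative values.\<close>

definition ergodic_density :: "real \<Rightarrow> ((real \<times> real) set \<Rightarrow> real) \<Rightarrow> bool" where
  "ergodic_density \<alpha> \<phi> \<longleftrightarrow> integrable (m_D \<alpha>) \<phi> \<and> (AE x in m_D \<alpha>. 0 \<le> \<phi> x) \<and>
     ergodic_probability (factor_map \<alpha>) (density (m_D \<alpha>) (\<lambda>x. ennreal (\<phi> x)))"

lemma G_map_unit_square:
  assumes "0 \<le> \<alpha>" "\<alpha> \<le> 1" "p \<in> unit_square"
  shows "G_map \<alpha> p \<in> unit_square"
proof -
  obtain x y where p: "p = (x, y)" by (cases p)
  have xy: "0 \<le> x" "x \<le> 1" "0 \<le> y" "y \<le> 1"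
    using assms(3) by (auto simp: p unit_square_def)
  define t where "t = \<alpha> * y + (1 - \<alpha>) * x"
  have "0 \<le> t" unfolding t_def using assms xy by simp
  moreover have "t \<le> \<alpha> * 1 + (1 - \<alpha>) * 1"
    unfolding t_def using assms xy by (intro add_mono mult_left_mono) auto
  ultimately have "tent t \<in> {0..1}"
    by (auto simp: tent_def abs_if)
  then show ?thesis
    using xy by (simp add: p G_map_def unit_square_def t_def)
qed

lemma G_map_funpow_unit_square:
  assumes "0 \<le> \<alpha>" "\<alpha> \<le> 1" "p \<in> unit_square"
  shows "(G_map \<alpha> ^^ n) p \<in> unit_square"
  by (induction n) (use assms G_map_unit_square in auto)

lemma partition_P_ex1:
  assumes "p \<in> unit_square"
  shows "\<exists>!B. B \<in> partition_P \<alpha> \<and> p \<in> B"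
proof (cases "p \<in> A1 \<alpha>")
  case True
  then show ?thesis by (auto simp: partition_P_def)
next
  case False
  then have "p \<in> A2 \<alpha> - A1 \<alpha>"
    using assms by (auto simp: A1_def A2_def)
  then show ?thesis by (auto simp: partition_P_def)
qed

lemma partition_P_minus_ex1:
  assumes "0 \<le> \<alpha>" "\<alpha> \<le> 1" "p \<in> unit_square"
  shows "\<exists>!C. C \<in> partition_P_minus \<alpha> \<and> p \<in> C"
proof -
  have "\<forall>n. \<exists>B. B \<in> partition_P \<alpha> \<and> (G_map \<alpha> ^^ n) p \<in> B"
    using partition_P_ex1 G_map_funpow_unit_square[OF assms] by blast
  then obtain B where B: "\<And>n. B n \<in> partition_P \<alpha>" "\<And>n. (G_map \<alpha> ^^ n) p \<in> B n"
    by metis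
  let ?C = "{q \<in> unit_square. \<forall>n. (G_map \<alpha> ^^ n) q \<in> B n}"
  show ?thesis
  proof (rule ex1I[of _ ?C])
    show "?C \<in> partition_P_minus \<alpha> \<and> p \<in> ?C"
      unfolding partition_P_minus_def using B assms(3) by blast
  next
    fix C assume C: "C \<in> partition_P_minus \<alpha> \<and> p \<in> C"
    then obtain B' where B': "\<And>n. B' n \<in> partition_P \<alpha>"
      "C = {q \<in> unit_square. \<forall>n. (G_map \<alpha> ^^ n) q \<in> B' n}"
      unfolding partition_P_minus_def by blast
    have "B' n = B n" for n
      using partition_P_ex1[OF G_map_funpow_unit_square[OF assms], of \<alpha> n] B B' C by blast
    then show "C = ?C" using B' by simp
  qed
qed

lemma proj_in: "0 \<le> \<alpha> \<Longrightarrow> \<alpha> \<le> 1 \<Longrightarrow> p \<in> unit_square \<Longrightarrow> proj \<alpha> p \<in> partition_P_minus \<alpha> \<and> p \<in> proj \<alpha> p"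
  unfolding proj_def by (rule theI') (rule partition_P_minus_ex1)

lemma proj_eq:
  "0 \<le> \<alpha> \<Longrightarrow> \<alpha> \<le> 1 \<Longrightarrow> C \<in> partition_P_minus \<alpha> \<Longrightarrow> p \<in> C \<Longrightarrow> p \<in> unit_square \<Longrightarrow> proj \<alpha> p = C"
  using partition_P_minus_ex1[of \<alpha> p] proj_in[of \<alpha> p] by blast

lemma factor_map_proj:
  assumes "0 \<le> \<alpha>" "\<alpha> \<le> 1" "p \<in> unit_square"
  shows "factor_map \<alpha> (proj \<alpha> p) = proj \<alpha> (G_map \<alpha> p)"
proof -
  define q where "q = (SOME q. q \<in> proj \<alpha> p)"
  have C: "proj \<alpha> p \<in> partition_P_minus \<alpha>" "p \<in> proj \<alpha> p"
    using proj_in[OF assms] by auto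
  have q: "q \<in> proj \<alpha> p" unfolding q_def by (rule someI) (rule C(2))
  obtain B where B: "\<And>n. B n \<in> partition_P \<alpha>"
    "proj \<alpha> p = {r \<in> unit_square. \<forall>n. (G_map \<alpha> ^^ n) r \<in> B n}"
    using C(1) unfolding partition_P_minus_def by blast
  let ?D = "{r \<in> unit_square. \<forall>n. (G_map \<alpha> ^^ n) r \<in> B (Suc n)}"
  have mem: "G_map \<alpha> r \<in> ?D" if "r \<in> proj \<alpha> p" for r
  proof -
    have r: "r \<in> unit_square" "\<And>n. (G_map \<alpha> ^^ n) r \<in> B n" using that B(2) by auto
    have "(G_map \<alpha> ^^ n) (G_map \<alpha> r) \<in> B (Suc n)" for n
      using r(2)[of "Suc n"] by (simp add: funpow_swap1)
    then show ?thesis using r(1) G_map_unit_square[OF assms(1,2)] by simp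
  qed
  have "?D \<in> partition_P_minus \<alpha>"
    unfolding partition_P_minus_def
  proof (intro CollectI conjI exI allI)
    show "?D \<noteq> {}" using mem[OF q] by blast
    show "B (Suc n) \<in> partition_P \<alpha>" for n by (rule B(1))
  qed (rule refl)
  then have "proj \<alpha> (G_map \<alpha> r) = ?D" if "r \<in> proj \<alpha> p" for r
    using proj_eq[OF assms(1,2)] mem[OF that] by blast
  then show ?thesis
    using q C(2) by (simp add: factor_map_def flip: q_def)
qed

lemma space_quotient_space: "space (quotient_space \<alpha>) = partition_P_minus \<alpha>"
  unfolding quotient_space_def by (rule space_measure_of) blast

lemma sets_quotient_space:
  assumes "0 \<le> \<alpha>" "\<alpha> \<le> 1"
  shows "sets (quotient_space \<alpha>) =
    {A. A \<subseteq> partition_P_minus \<alpha> \<and> proj \<alpha> -` A \<inter> unit_square \<in> sets borel}" (is "_ = ?S")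
proof -
  have sq: "unit_square \<in> sets borel"
    unfolding unit_square_def by (intro borel_closed closed_Times) auto
  have "sigma_algebra (partition_P_minus \<alpha>) ?S"
  proof (rule sigma_algebra_iff2[THEN iffD2], intro conjI ballI allI impI)
    show "?S \<subseteq> Pow (partition_P_minus \<alpha>)" by blast
    show "{} \<in> ?S" by simp
  next
    fix A assume A: "A \<in> ?S"
    have "proj \<alpha> -` (partition_P_minus \<alpha> - A) \<inter> unit_square
        = unit_square - (proj \<alpha> -` A \<inter> unit_square)"
      using proj_in[OF assms] by blast
    with A sq show "partition_P_minus \<alpha> - A \<in> ?S" by auto
  next
    fix F :: "nat \<Rightarrow> (real \<times> real) set set" assume F: "range F \<subseteq> ?S"
    have "proj \<alpha> -` (\<Union>i. F i) \<inter> unit_square = (\<Union>i. proj \<alpha> -` F i \<inter> unit_square)"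
      by blast
    moreover have "\<dots> \<in> sets borel" using F by (intro sets.countable_UN) blast
    ultimately show "(\<Union>i. F i) \<in> ?S" using F by auto
  qed
  then show ?thesis
    unfolding quotient_space_def by (simp add: sigma_algebra.sets_measure_of_eq)
qed

lemma proj_measurable:
  assumes "0 \<le> \<alpha>" "\<alpha> \<le> 1"
  shows "proj \<alpha> \<in> restrict_space borel unit_square \<rightarrow>\<^sub>M quotient_space \<alpha>"
proof (rule measurableI)
  have sq: "unit_square \<in> sets borel"
    unfolding unit_square_def by (intro borel_closed closed_Times) auto
  show "proj \<alpha> p \<in> space (quotient_space \<alpha>)" if "p \<in> space (restrict_space borel unit_square)" for p
    using that proj_in[OF assms] by (simp add: space_quotient_space space_restrict_space)
  show "proj \<alpha> -` A \<inter> space (restrict_space borel unit_square) \<in> sets (restrict_space borel unit_square)"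
    if "A \<in> sets (quotient_space \<alpha>)" for A
    using that sq by (auto simp: sets_quotient_space[OF assms] sets_restrict_space_iff space_restrict_space)
qed

end

theory Submission
  imports Defs
begin

text \<open>
  The map \<open>G\<close> is continuous and uniformly contracts the elements of the partition, so a point of a
  full \<open>G\<close>-orbit is determined by its two-sided itinerary with respect to the two sides of the line
  \<open>\<alpha> y + (1 - \<alpha>) x = 1/2\<close>, where \<open>G\<close> folds the square. The one-sided (future) itinerary is the same
  information as the point of the quotient \<open>X\<close>. Hence the lift of an invariant probability \<open>\<kappa>\<close> on
  \<open>X\<close> is forced: extend the law of the future itinerary to a shift-invariant law on two-sided
  sequences (the natural extension), and send a two-sided sequence \<open>\<omega>\<close> to
  \<open>Z(\<omega>) = lim G^n(p_n)\<close>, where \<open>p_n\<close> is any point following the symbols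
  \<open>\<omega>(-n), \<dots>, \<omega>(n)\<close>. The law \<open>\<mu>\<close> of \<open>Z\<close> is \<open>G\<close>-invariant.

  The hard point is that \<open>\<mu>\<close> projects to \<open>\<kappa>\<close>: a limit of points on one side of the fold line may
  lie on the line, and then \<open>Z(\<omega>)\<close> need not have the future itinerary of \<open>\<omega>\<close>. It has to be shown
  that \<open>\<mu>\<close> does not charge the fold line. Here the hypothesis on the density enters, in the form
  \<open>\<kappa> \<lless> \<pi>\<^sub>*(Lebesgue)\<close>, in three steps.

  \<^item> Points whose itineraries agree are contracted at the rate \<open>\<lambda>\<^sub>1\<close>, the smaller root of
  \<open>x\<^sup>2 - 2 \<alpha> x + 2 (1 - \<alpha>)\<close>; the larger root \<open>\<lambda>\<^sub>2\<close> exceeds \<open>1\<close> because \<open>\<alpha> > 3/4\<close>. Two points that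
  agree for a long but finite time are contracted up to an error \<open>\<lambda>\<^sub>2\<^sup>-\<^sup>k\<close>.
  \<^item> The preimage of a set under \<open>G\<close> has at most \<open>1/(1 - \<alpha>) = 2/(\<lambda>\<^sub>1 \<lambda>\<^sub>2)\<close> times its area, so the set
  of points attracted to a given orbit at the rate \<open>\<lambda>\<^sub>1\<close> has area at most a constant times
  \<open>(2 \<lambda>\<^sub>1/\<lambda>\<^sub>2)^n\<close> for every \<open>n\<close>, that is, area zero. Therefore \<open>\<mu>\<close> has no atoms.
  \<^item> Only countably many points of the fold line return to it, because the images of the line are
  unstable curves transversal to it. By Poincare recurrence \<open>\<mu>\<close>-almost every point of the line does
  return, so \<open>\<mu>\<close> charges the line at most by atoms, hence not at all.

  It follows that \<open>\<mu>\<close> and an absolutely continuous lift \<open>\<mu>\<^sub>0\<close> of \<open>\<kappa>\<close> give the itinerary the same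
  law. The quotient \<open>\<sigma>\<close>-algebra is formally larger than the one generated by the itinerary, but an
  argument in the manner of Blackwell's theorem shows that \<open>\<mu>\<close> and \<open>\<mu>\<^sub>0\<close> agree on all Borel sets that
  are unions of fibers.
\<close>

section \<open>Borel sets that are unions of fibers\<close>

text \<open>A Borel set \<open>S\<close> that is a union of fibers of \<open>e\<close> need not visibly be the preimage of a Borel set. It
  is, however, exhausted from inside by such preimages: transport \<open>M\<close> to the graph of \<open>e\<close> and
  approximate from inside by compact subsets of the graph over \<open>S\<close>. Their projections to the second
  factor are compact, and by saturation the preimages of these projections stay within \<open>S\<close>. The set
  \<open>U\<close> allows saturation to be tested on a set of full \<open>N\<close>-measure only.\<close>

lemma saturated_measure_le:
  fixes e :: "'a::polish_space \<Rightarrow> 'b::polish_space"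
  assumes M: "sets M = sets borel" "finite_measure M" and N: "sets N = sets borel"
    and e [measurable]: "e \<in> borel_measurable borel"
    and eq: "distr M borel e = distr N borel e"
    and S [measurable]: "S \<in> sets borel" and U [measurable]: "U \<in> sets borel"
    and N0: "emeasure N (- U) = 0"
    and sat: "\<And>p q. p \<in> S \<Longrightarrow> q \<in> U \<Longrightarrow> e p = e q \<Longrightarrow> q \<in> S"
  shows "emeasure M S \<le> emeasure N S"
proof -
  have [measurable_cong]: "sets M = sets borel" "sets N = sets borel" by fact+
  interpret finite_measure M by fact
  have space: "space M = UNIV" "space N = UNIV"
    using M(1) N sets_eq_imp_space_eq[of _ borel] by auto
  define \<Gamma> where "\<Gamma> = {x. fst x \<in> S \<and> e (fst x) = snd x}"
  define F where "F = distr M borel (\<lambda>p. (p, e p))"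
  have graph [measurable]: "(\<lambda>p. (p, e p)) \<in> borel_measurable M"
    using e by (intro borel_measurable_Pair) (auto simp: measurable_cong_sets[OF M(1) refl])
  have G: "\<Gamma> \<in> sets borel"
  proof -
    have "{x. x \<in> space (borel :: ('a \<times> 'b) measure) \<and> fst x \<in> S \<and> e (fst x) = snd x} \<in> sets borel"
      unfolding borel_prod[symmetric] by measurable
    then show ?thesis by (simp add: \<Gamma>_def)
  qed
  have "emeasure M S = emeasure F \<Gamma>"
    unfolding F_def using G by (subst emeasure_distr) (auto simp: \<Gamma>_def space)
  also have "\<dots> = (SUP K \<in> {K. K \<subseteq> \<Gamma> \<and> compact K}. emeasure F K)"
  proof (rule inner_regular)
    show "emeasure F (space F) \<noteq> \<infinity>"
      by (simp add: F_def emeasure_distr)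
  qed (auto simp: F_def G)
  also have "\<dots> \<le> emeasure N S"
  proof (rule SUP_least, clarify)
    fix K assume K: "K \<subseteq> \<Gamma>" "compact K"
    define C where "C = snd ` K"
    have "compact C" unfolding C_def
      by (rule compact_continuous_image[OF _ K(2)]) (intro continuous_intros)
    then have C [measurable]: "C \<in> sets borel" by (simp add: borel_compact)
    have K' [measurable]: "K \<in> sets borel" using K(2) by (simp add: borel_compact)
    have "emeasure F K = emeasure M {p. (p, e p) \<in> K}"
      unfolding F_def by (subst emeasure_distr) (auto simp: space vimage_def)
    also have "\<dots> \<le> emeasure M (e -` C)"
      by (rule emeasure_mono) (use M(1) measurable_sets_borel[OF e C] in \<open>force simp: C_def\<close>)+
    also have "\<dots> = emeasure (distr M borel e) C"
      by (subst emeasure_distr) (auto simp: space)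
    also have "\<dots> = emeasure N (e -` C)"
      unfolding eq by (subst emeasure_distr) (auto simp: space)
    also have "\<dots> \<le> emeasure N (S \<union> - U)"
    proof (rule emeasure_mono)
      show "e -` C \<subseteq> S \<union> - U"
        using K(1) sat by (fastforce simp: C_def \<Gamma>_def)
    qed (use N S U in auto)
    also have "\<dots> \<le> emeasure N S + emeasure N (- U)"
      by (rule emeasure_subadditive) (use N S U in auto)
    finally show "emeasure F K \<le> emeasure N S" using N0 by simp
  qed
  finally show ?thesis .
qed

section \<open>Natural extension of a stationary process\<close>

lemma prod_emb_UNIV_PiE:
  "prod_emb UNIV (\<lambda>_. borel :: 'a::topological_space measure) J (PiE J A) = {\<omega>. \<forall>j\<in>J. \<omega> j \<in> A j}"
  by (auto simp: prod_emb_def PiE_iff)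

lemma cylinder_in_sets_PiM:
  assumes "finite J" "\<And>j. j \<in> J \<Longrightarrow> A j \<in> sets (borel :: 'a::topological_space measure)"
  shows "{\<omega>. \<forall>j\<in>J. \<omega> j \<in> A j} \<in> sets (PiM UNIV (\<lambda>_. borel))"
  using sets_PiM_I[of J UNIV A "\<lambda>_. borel"] assms by (simp add: prod_emb_UNIV_PiE)

lemma measure_eqI_cylinders:
  fixes P R :: "('i \<Rightarrow> 'a::topological_space) measure"
  assumes "sets P = sets (PiM UNIV (\<lambda>_. borel))" "sets R = sets (PiM UNIV (\<lambda>_. borel))"
    and "finite_measure P"
    and "\<And>A J. finite J \<Longrightarrow> (\<And>j. j \<in> J \<Longrightarrow> A j \<in> sets borel) \<Longrightarrow>
      emeasure P {\<omega>. \<forall>j\<in>J. \<omega> j \<in> A j} = emeasure R {\<omega>. \<forall>j\<in>J. \<omega> j \<in> A j}"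
  shows "P = R"
  by (rule measure_eqI_PiM_infinite[OF assms(1,2)]) (use assms(3,4) in \<open>simp_all add: prod_emb_UNIV_PiE\<close>)

lemma distr_shift_funpow:
  fixes Q :: "(nat \<Rightarrow> 'a::polish_space) measure"
  assumes Q: "sets Q = sets (PiM UNIV (\<lambda>_. borel))"
    and stat: "distr Q (PiM UNIV (\<lambda>_. borel)) (\<lambda>\<eta> i. \<eta> (Suc i)) = Q"
  shows "distr Q (PiM UNIV (\<lambda>_. borel)) (\<lambda>\<eta> i. \<eta> (i + d)) = Q"
proof (induction d)
  case 0
  then show ?case using Q by (simp add: distr_id2)
next
  case (Suc d)
  have [measurable_cong]: "sets Q = sets (PiM UNIV (\<lambda>_. borel))" by fact
  have m: "(\<lambda>\<eta> i. \<eta> (Suc i)) \<in> Q \<rightarrow>\<^sub>M PiM UNIV (\<lambda>_. borel)"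
    by (rule measurable_PiM_single') auto
  have m': "(\<lambda>\<eta> i. \<eta> (i + d)) \<in> PiM UNIV (\<lambda>_. borel) \<rightarrow>\<^sub>M PiM UNIV (\<lambda>_. borel :: 'a measure)"
    by (rule measurable_PiM_single') auto
  have "distr Q (PiM UNIV (\<lambda>_. borel)) (\<lambda>\<eta> i. \<eta> (i + Suc d)) =
      distr (distr Q (PiM UNIV (\<lambda>_. borel)) (\<lambda>\<eta> i. \<eta> (Suc i))) (PiM UNIV (\<lambda>_. borel)) (\<lambda>\<eta> i. \<eta> (i + d))"
    by (subst distr_distr[OF m' m]) (simp add: o_def)
  then show ?case by (simp add: stat Suc)
qed

text \<open>Kolmogorov's extension theorem. The marginal on a finite set \<open>J\<close> of integers is read off from \<open>Q\<close>
  after a translation of \<open>J\<close> into the natural numbers; stationarity makes the result independent of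
  the translation, which is the consistency condition.\<close>

lemma natural_extension:
  fixes Q :: "(nat \<Rightarrow> 'a::polish_space) measure"
  assumes "prob_space Q" and Q: "sets Q = sets (PiM UNIV (\<lambda>_. borel))"
    and stat: "distr Q (PiM UNIV (\<lambda>_. borel)) (\<lambda>\<eta> i. \<eta> (Suc i)) = Q"
  obtains P :: "(int \<Rightarrow> 'a) measure" where "prob_space P"
    "sets P = sets (PiM UNIV (\<lambda>_. borel))"
    "\<And>N. distr P (PiM UNIV (\<lambda>_. borel)) (\<lambda>\<omega> i. \<omega> (int i - int N)) = Q"
    "distr P (PiM UNIV (\<lambda>_. borel)) (\<lambda>\<omega> i. \<omega> (i + 1)) = P"
proof -
  have [measurable_cong]: "sets Q = sets (PiM UNIV (\<lambda>_. borel))" by fact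
  have space_Q: "space Q = UNIV" using sets_eq_imp_space_eq[OF Q] by (simp add: space_PiM)
  interpret Q: prob_space Q by fact
  define F where "F N J = distr Q (PiM J (\<lambda>_. borel :: 'a measure)) (\<lambda>\<eta>. \<lambda>j\<in>J. \<eta> (nat (j + int N)))" for N J
  have mF [measurable]: "(\<lambda>\<eta>. \<lambda>j\<in>J. \<eta> (nat (j + int N))) \<in> PiM UNIV (\<lambda>_. borel) \<rightarrow>\<^sub>M PiM J (\<lambda>_. borel :: 'a measure)" for N J
    by (rule measurable_restrict) simp
  have F_cong: "F N J = F N' J" if "N \<le> N'" "J \<subseteq> {- int N..}" for N N' J
  proof -
    define d where "d = N' - N"
    have sh: "(\<lambda>\<eta> i. \<eta> (i + d)) \<in> Q \<rightarrow>\<^sub>M PiM UNIV (\<lambda>_. borel)"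
      by (rule measurable_PiM_single') auto
    have "F N J = distr (distr Q (PiM UNIV (\<lambda>_. borel)) (\<lambda>\<eta> i. \<eta> (i + d))) (PiM J (\<lambda>_. borel))
        (\<lambda>\<eta>. \<lambda>j\<in>J. \<eta> (nat (j + int N)))"
      by (simp add: F_def distr_shift_funpow[OF Q stat])
    also have "\<dots> = distr Q (PiM J (\<lambda>_. borel)) (\<lambda>\<eta>. \<lambda>j\<in>J. \<eta> (nat (j + int N) + d))"
      by (subst distr_distr[OF mF sh]) (simp add: o_def)
    also have "\<dots> = F N' J"
    proof -
      have "nat (j + int N) + d = nat (j + int N')" if "j \<in> J" for j
        using \<open>J \<subseteq> _\<close> \<open>N \<le> N'\<close> that by (auto simp: d_def)
      then show ?thesis unfolding F_def by (intro distr_cong refl) (auto simp: restrict_def fun_eq_iff)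
    qed
    finally show ?thesis .
  qed
  \<comment> \<open>a translation that moves \<open>J\<close> into the natural numbers\<close>
  define low where "low J = nat (- Min (insert 0 J))" for J :: "int set"
  have low: "J \<subseteq> {- int (low J)..}" if "finite J" for J
    using that unfolding low_def by (auto simp: Min_le_iff min_def)
  have low_mono: "low J \<le> low H" if "J \<subseteq> H" "finite H" for J H
  proof -
    have "Min (insert 0 H) \<le> Min (insert 0 J)" using that by (intro Min_antimono) auto
    then show ?thesis by (simp add: low_def)
  qed
  interpret P: polish_projective UNIV "\<lambda>J. F (low J) J"
  proof (rule polish_projective.intro, rule projective_family.intro)
    fix J H :: "int set" assume J: "J \<subseteq> H" "finite H"
    have "F (low J) J = F (low H) J"
      using J by (intro F_cong low_mono low) (auto intro: finite_subset)
    also have "\<dots> = distr (F (low H) H) (PiM J (\<lambda>_. borel)) (\<lambda>f. restrict f J)"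
    proof -
      have r: "(\<lambda>f. restrict f J) \<in> PiM H (\<lambda>_. borel) \<rightarrow>\<^sub>M PiM J (\<lambda>_. borel :: 'a measure)"
        using J by (intro measurable_restrict_subset)
      have "(\<lambda>f. restrict f J) \<circ> (\<lambda>\<eta>. \<lambda>j\<in>H. \<eta> (nat (j + int (low H)))) = (\<lambda>\<eta>. \<lambda>j\<in>J. \<eta> (nat (j + int (low H))) :: 'a)"
        using J by (auto simp: fun_eq_iff restrict_def)
      then show ?thesis unfolding F_def by (subst distr_distr[OF r]) (auto simp: o_def)
    qed
    finally show "F (low J) J = distr (F (low H) H) (PiM J (\<lambda>_. borel)) (\<lambda>f. restrict f J)" .
  next
    fix J :: "int set"
    show "prob_space (F (low J) J)"
      unfolding F_def by (rule Q.prob_space_distr) (simp add: measurable_cong_sets[OF Q refl] mF)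
  qed
  define P where "P = P.lim"
  have P: "prob_space P" "sets P = sets (PiM UNIV (\<lambda>_. borel))"
    unfolding P_def by (rule P.P.prob_space_axioms) simp
  have [measurable_cong]: "sets P = sets (PiM UNIV (\<lambda>_. borel))" by (rule P(2))
  have space_P: "space P = UNIV" using sets_eq_imp_space_eq[OF P(2)] by (simp add: space_PiM)
  have fin: "emeasure P {\<omega>. \<forall>j\<in>J. \<omega> j \<in> A j} = emeasure Q {\<eta>. \<forall>j\<in>J. \<eta> (nat (j + int N)) \<in> A j}"
    if J: "finite J" "J \<subseteq> {- int N..}" and A: "\<And>j. j \<in> J \<Longrightarrow> A j \<in> sets borel" for J N and A :: "int \<Rightarrow> 'a set"
  proof -
    have "emeasure P {\<omega>. \<forall>j\<in>J. \<omega> j \<in> A j} = emeasure (F (low J) J) (PiE J A)"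
      unfolding P_def using J A
      by (simp add: prod_emb_UNIV_PiE[symmetric] P.emeasure_lim_emb sets_PiM_I_finite)
    also have "F (low J) J = F N J"
      using J by (metis F_cong low nle_le)
    also have "emeasure \<dots> (PiE J A) = emeasure Q {\<eta>. \<forall>j\<in>J. \<eta> (nat (j + int N)) \<in> A j}"
      unfolding F_def using J A
      by (subst emeasure_distr) (auto simp: sets_PiM_I_finite space_Q PiE_iff intro!: arg_cong[where f = "emeasure Q"])
    finally show ?thesis .
  qed
  interpret P': prob_space P by (rule P)
  have past: "distr P (PiM UNIV (\<lambda>_. borel)) (\<lambda>\<omega> i. \<omega> (int i - int N)) = Q" for N
  proof (rule sym, rule measure_eqI_cylinders[OF Q])
    show "finite_measure Q" by unfold_locales
    fix A and J :: "nat set" assume J: "finite J" "\<And>i. i \<in> J \<Longrightarrow> A i \<in> sets (borel :: 'a measure)"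
    let ?J = "(\<lambda>i. int i - int N) ` J"
    have m: "(\<lambda>\<omega> i. \<omega> (int i - int N)) \<in> P \<rightarrow>\<^sub>M PiM UNIV (\<lambda>_. borel)"
      by (rule measurable_PiM_single') auto
    have "emeasure (distr P (PiM UNIV (\<lambda>_. borel)) (\<lambda>\<omega> i. \<omega> (int i - int N))) {\<omega>. \<forall>j\<in>J. \<omega> j \<in> A j}
       = emeasure P {\<omega>. \<forall>j\<in>?J. \<omega> j \<in> A (nat (j + int N))}"
      using J by (subst emeasure_distr[OF m])
        (auto simp: space_P cylinder_in_sets_PiM intro!: arg_cong[where f = "emeasure P"])
    also have "\<dots> = emeasure Q {\<eta>. \<forall>j\<in>?J. \<eta> (nat (j + int N)) \<in> A (nat (j + int N))}"
      using J by (intro fin) auto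
    also have "\<dots> = emeasure Q {\<omega>. \<forall>j\<in>J. \<omega> j \<in> A j}"
      by (rule arg_cong[where f = "emeasure Q"]) auto
    finally show "emeasure Q {\<omega>. \<forall>j\<in>J. \<omega> j \<in> A j} =
      emeasure (distr P (PiM UNIV (\<lambda>_. borel)) (\<lambda>\<omega> i. \<omega> (int i - int N))) {\<omega>. \<forall>j\<in>J. \<omega> j \<in> A j}" ..
  qed auto
  have shift: "distr P (PiM UNIV (\<lambda>_. borel)) (\<lambda>\<omega> i. \<omega> (i + 1)) = P"
  proof (rule sym, rule measure_eqI_cylinders[OF P(2)])
    show "finite_measure P" by unfold_locales
    fix A and J :: "int set" assume J: "finite J" "\<And>i. i \<in> J \<Longrightarrow> A i \<in> sets (borel :: 'a measure)"
    let ?J = "(\<lambda>i. i + 1) ` J"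
    have m: "(\<lambda>\<omega> i. \<omega> (i + 1)) \<in> P \<rightarrow>\<^sub>M PiM UNIV (\<lambda>_. borel)"
      by (rule measurable_PiM_single') auto
    have "emeasure (distr P (PiM UNIV (\<lambda>_. borel)) (\<lambda>\<omega> i. \<omega> (i + 1))) {\<omega>. \<forall>j\<in>J. \<omega> j \<in> A j}
       = emeasure P {\<omega>. \<forall>j\<in>?J. \<omega> j \<in> A (j - 1)}"
      using J by (subst emeasure_distr[OF m])
        (auto simp: space_P cylinder_in_sets_PiM intro!: arg_cong[where f = "emeasure P"])
    also have "\<dots> = emeasure Q {\<eta>. \<forall>j\<in>?J. \<eta> (nat (j + int (low J))) \<in> A (j - 1)}"
      using J low[of J] by (intro fin) auto
    also have "\<dots> = emeasure Q {\<eta>. \<forall>j\<in>J. \<eta> (nat (j + int (Suc (low J)))) \<in> A j}"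
      by (rule arg_cong[where f = "emeasure Q"]) (auto simp: algebra_simps)
    also have "\<dots> = emeasure P {\<omega>. \<forall>j\<in>J. \<omega> j \<in> A j}"
      using J low[of J] by (intro fin[symmetric]) auto
    finally show "emeasure P {\<omega>. \<forall>j\<in>J. \<omega> j \<in> A j} =
      emeasure (distr P (PiM UNIV (\<lambda>_. borel)) (\<lambda>\<omega> i. \<omega> (i + 1))) {\<omega>. \<forall>j\<in>J. \<omega> j \<in> A j}" ..
  qed auto
  show ?thesis using that[OF P past shift] .
qed

section \<open>Itineraries and the rates of the linear recursion\<close>

definition side_form :: "real \<Rightarrow> real \<times> real \<Rightarrow> real" where
  "side_form \<alpha> p = \<alpha> * snd p + (1 - \<alpha>) * fst p"

text \<open>The strict inequality follows the convention that the fold line belongs to \<^const>\<open>A1\<close>.\<close>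

definition upper :: "real \<Rightarrow> nat \<Rightarrow> real \<times> real \<Rightarrow> bool" where
  "upper \<alpha> i p \<longleftrightarrow> 1/2 < side_form \<alpha> ((G_map \<alpha> ^^ i) p)"

locale steep =
  fixes \<alpha> :: real
  assumes steep: "3/4 < \<alpha>" and less_1: "\<alpha> < 1"
begin

abbreviation G :: "real \<times> real \<Rightarrow> real \<times> real" where "G \<equiv> G_map \<alpha>"

definition contr :: real where "contr = \<alpha> - sqrt (\<alpha>\<^sup>2 + 2 * \<alpha> - 2)"
definition expan :: real where "expan = \<alpha> + sqrt (\<alpha>\<^sup>2 + 2 * \<alpha> - 2)"

text \<open>\<open>contr\<close> and \<open>expan\<close> are the roots \<open>\<lambda>\<^sub>1\<close> and \<open>\<lambda>\<^sub>2\<close> of \<open>x\<^sup>2 - 2 \<alpha> x + 2 (1 - \<alpha>)\<close>. At \<open>x = 1\<close> this polynomial takes the value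
  \<open>3 - 4 \<alpha>\<close>, so \<open>\<alpha> > 3/4\<close> says that \<open>1\<close> separates the roots.\<close>

lemma rates:
  "contr + expan = 2 * \<alpha>" "contr * expan = 2 * (1 - \<alpha>)"
  "0 < contr" "contr < 1/2" "1 < expan"
proof -
  define D where "D = \<alpha>\<^sup>2 + 2 * \<alpha> - 2"
  have D: "(1 - \<alpha>)\<^sup>2 < D" using steep by (simp add: D_def power2_eq_square algebra_simps)
  then have "1 - \<alpha> < sqrt D" using less_1 by (simp add: real_less_rsqrt)
  then show e: "1 < expan" by (simp add: expan_def D_def)
  show "contr + expan = 2 * \<alpha>" by (simp add: contr_def expan_def)
  have "0 \<le> D" using D by (smt (verit) zero_le_power2)
  then have "contr * expan = \<alpha>\<^sup>2 - D"
    by (simp add: contr_def expan_def flip: D_def) (simp add: algebra_simps power2_eq_square)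
  then show p: "contr * expan = 2 * (1 - \<alpha>)" by (simp add: D_def)
  then show c: "0 < contr" using e less_1 by (smt (verit) mult_nonpos_nonneg)
  have "contr * 1 < contr * expan" using c e by (intro mult_strict_left_mono)
  then show "contr < 1/2" using p steep by simp
qed

lemma abs_combination_ge: "2 * \<alpha> * \<bar>a\<bar> - 2 * (1 - \<alpha>) * \<bar>b\<bar> \<le> 2 * \<bar>\<alpha> * a + (1 - \<alpha>) * b\<bar>"
proof -
  define x where "x = \<bar>\<alpha> * a + (1 - \<alpha>) * b\<bar>"
  have "\<alpha> * \<bar>a\<bar> - (1 - \<alpha>) * \<bar>b\<bar> \<le> x"
    using abs_triangle_ineq2[of "\<alpha> * a" "- ((1 - \<alpha>) * b)"] steep less_1 by (simp add: x_def abs_mult)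
  then show ?thesis unfolding x_def[symmetric] by (simp add: algebra_simps)
qed

section \<open>Contraction of points with the same itinerary\<close>

text \<open>Here \<open>d i\<close> is the difference of the first coordinates of the \<open>i\<close>-th iterates of two points. The
  quantity \<open>u i = |d (i + 1)| - \<lambda>\<^sub>1 |d i|\<close> grows at least by the factor \<open>\<lambda>\<^sub>2\<close> in each step, because
  \<open>\<lambda>\<^sub>1 + \<lambda>\<^sub>2 = 2 \<alpha>\<close> and \<open>\<lambda>\<^sub>1 \<lambda>\<^sub>2 = 2 (1 - \<alpha>)\<close>; since it stays below \<open>1\<close>, it is at most
  \<open>\<lambda>\<^sub>2\<^sup>-\<^sup>k\<close> while \<open>k\<close> steps remain.\<close>

lemma displacement_step:
  fixes d :: "nat \<Rightarrow> real"
  assumes rec: "\<And>i. i < k \<Longrightarrow> \<bar>d (Suc (Suc i))\<bar> = 2 * \<bar>\<alpha> * d (Suc i) + (1 - \<alpha>) * d i\<bar>"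
    and bound: "\<And>i. \<bar>d i\<bar> \<le> 1" and "i \<le> k"
  shows "\<bar>d (Suc i)\<bar> \<le> contr * \<bar>d i\<bar> + (1 / expan) ^ (k - i)"
proof -
  define u where "u i = \<bar>d (Suc i)\<bar> - contr * \<bar>d i\<bar>" for i
  have step: "expan * u i \<le> u (Suc i)" if "i < k" for i
  proof -
    have "2 * \<alpha> * \<bar>d (Suc i)\<bar> - 2 * (1 - \<alpha>) * \<bar>d i\<bar> \<le> \<bar>d (Suc (Suc i))\<bar>"
      using abs_combination_ge by (simp only: rec[OF that])
    then show ?thesis
      unfolding rates(1)[symmetric] rates(2)[symmetric] by (simp add: u_def algebra_simps)
  qed
  have iter: "expan ^ j * u i \<le> u (i + j)" if "i + j \<le> k" for j
    using that
  proof (induction j)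
    case (Suc j)
    have "expan * (expan ^ j * u i) \<le> expan * u (i + j)"
      using Suc rates by (intro mult_left_mono) auto
    also have "\<dots> \<le> u (Suc (i + j))" using Suc by (intro step) auto
    finally show ?case by (simp add: mult.assoc)
  qed simp
  have "expan ^ (k - i) * u i \<le> u k" using iter[of "k - i"] \<open>i \<le> k\<close> by simp
  also have "u k \<le> 1"
    using bound[of "Suc k"] rates(3) by (auto simp: u_def intro: order_trans[rotated])
  finally have "u i \<le> (1 / expan) ^ (k - i)"
    using rates(5) by (simp add: field_simps)
  then show ?thesis by (simp add: u_def)
qed

lemma displacement_decay:
  fixes d :: "nat \<Rightarrow> real"
  assumes rec: "\<And>i. i < k \<Longrightarrow> \<bar>d (Suc (Suc i))\<bar> = 2 * \<bar>\<alpha> * d (Suc i) + (1 - \<alpha>) * d i\<bar>"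
    and bound: "\<And>i. \<bar>d i\<bar> \<le> 1" and "n \<le> Suc k"
  shows "\<bar>d n\<bar> \<le> contr ^ n + 2 * (1 / expan) ^ (Suc k - n)"
  using \<open>n \<le> Suc k\<close>
proof (induction n)
  case 0
  have "0 \<le> (1 / expan) ^ Suc k" using rates(5) by simp
  then show ?case using bound[of 0] by simp
next
  case (Suc n)
  define x where "x = (1 / expan) ^ (k - n)"
  have x: "0 \<le> x" unfolding x_def using rates(5) by simp
  have sk: "Suc k - n = Suc (k - n)" using Suc by simp
  have "\<bar>d (Suc n)\<bar> \<le> contr * \<bar>d n\<bar> + x"
    unfolding x_def using Suc by (intro displacement_step rec bound) auto
  also have "contr * \<bar>d n\<bar> \<le> contr * (contr ^ n + 2 * (1 / expan) ^ (Suc k - n))"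
    using Suc rates by (intro mult_left_mono) auto
  also have "\<dots> = contr ^ Suc n + (2 * contr / expan) * x"
    by (simp add: x_def sk algebra_simps)
  also have "(2 * contr / expan) * x \<le> 1 * x"
    using rates x by (intro mult_right_mono) auto
  finally show ?case by (simp add: x_def)
qed

lemma coordinates_G: "fst (G p) = snd p" "snd (G p) = tent (side_form \<alpha> p)"
  by (simp_all add: G_map_def side_form_def split_beta)

lemma fst_funpow_Suc: "fst ((G ^^ Suc i) p) = snd ((G ^^ i) p)"
  by (simp add: coordinates_G)

lemma displacement_rec:
  assumes "upper \<alpha> i p = upper \<alpha> i q"
  defines "d \<equiv> \<lambda>j. fst ((G ^^ j) p) - fst ((G ^^ j) q)"
  shows "\<bar>d (Suc (Suc i))\<bar> = 2 * \<bar>\<alpha> * d (Suc i) + (1 - \<alpha>) * d i\<bar>"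
proof -
  define P where "P = (G ^^ i) p"
  define Q where "Q = (G ^^ i) q"
  have "(1/2 < side_form \<alpha> P) = (1/2 < side_form \<alpha> Q)"
    using assms by (simp add: upper_def P_def Q_def)
  then have "\<bar>tent (side_form \<alpha> P) - tent (side_form \<alpha> Q)\<bar> = 2 * \<bar>side_form \<alpha> P - side_form \<alpha> Q\<bar>"
    by (auto simp: tent_def abs_if)
  then show ?thesis
    by (simp add: d_def coordinates_G P_def Q_def side_form_def algebra_simps)
qed

lemma G_square: "p \<in> unit_square \<Longrightarrow> (G ^^ n) p \<in> unit_square"
  using G_map_funpow_unit_square[of \<alpha> p n] steep less_1 by simp

text \<open>The bound for the distance at time \<open>n\<close> of two orbits with a common itinerary up to time \<open>k\<close>: the
  first term is the contraction along the fiber, the second one the width of the cylinder.\<close>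

definition orbit_bound :: "nat \<Rightarrow> nat \<Rightarrow> real" where
  "orbit_bound n k = 2 * contr ^ n + 4 * (1 / expan) ^ (k - n)"

lemma dist_iterates_le:
  assumes "p \<in> unit_square" "q \<in> unit_square"
    and same: "\<And>i. i < k \<Longrightarrow> upper \<alpha> i p = upper \<alpha> i q" and "n \<le> k"
  shows "dist ((G ^^ n) p) ((G ^^ n) q) \<le> orbit_bound n k"
proof -
  define d where "d j = fst ((G ^^ j) p) - fst ((G ^^ j) q)" for j
  have b: "\<bar>d i\<bar> \<le> 1" for i
    using G_square[OF assms(1), of i] G_square[OF assms(2), of i]
    by (auto simp: d_def unit_square_def mem_Times_iff)
  have r: "\<bar>d (Suc (Suc i))\<bar> = 2 * \<bar>\<alpha> * d (Suc i) + (1 - \<alpha>) * d i\<bar>" if "i < k" for i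
    unfolding d_def by (rule displacement_rec) (rule same[OF that])
  have "dist ((G ^^ n) p) ((G ^^ n) q) \<le> \<bar>d n\<bar> + \<bar>d (Suc n)\<bar>"
    unfolding dist_prod_def dist_real_def d_def fst_funpow_Suc
    by (simp add: sqrt_sum_squares_le_sum_abs)
  also have "\<bar>d n\<bar> \<le> contr ^ n + 2 * (1 / expan) ^ (Suc k - n)"
    using \<open>n \<le> k\<close> by (intro displacement_decay r b) auto
  also have "\<bar>d (Suc n)\<bar> \<le> contr ^ Suc n + 2 * (1 / expan) ^ (Suc k - Suc n)"
    using \<open>n \<le> k\<close> by (intro displacement_decay r b) auto
  also have "(1 / expan) ^ (Suc k - n) \<le> (1 / expan) ^ (k - n)"
    using rates(5) by (intro power_decreasing) auto
  also have "contr ^ Suc n \<le> contr ^ n"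
    using rates by (intro power_decreasing) auto
  finally show ?thesis by (simp add: orbit_bound_def)
qed

section \<open>Returns to the fold line\<close>

text \<open>A displacement \<open>(d\<^sub>0, d\<^sub>1)\<close> along the fold line is annihilated by the linear form, so \<open>d\<^sub>2 = 0\<close>.
  If the displacement is not zero, \<open>|d\<^sub>i|\<close> is positive and non-decreasing from \<open>i = 3\<close> on,
  whereas a displacement along the line satisfies \<open>|d\<^sub>n\<^sub>+\<^sub>1| = (1 - \<alpha>)/\<alpha> |d\<^sub>n| < |d\<^sub>n|\<close>. An image of the line is therefore never parallel to the
  line, and each word of symbols belongs to at most one returning point.\<close>

lemma return_unique:
  assumes z: "side_form \<alpha> z = 1/2" "side_form \<alpha> z' = 1/2" and "0 < n"
    and ret: "side_form \<alpha> ((G ^^ n) z) = 1/2" "side_form \<alpha> ((G ^^ n) z') = 1/2"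
    and same: "\<And>i. i < n \<Longrightarrow> upper \<alpha> i z = upper \<alpha> i z'"
  shows "z = z'"
proof -
  define d where "d j = fst ((G ^^ j) z) - fst ((G ^^ j) z')" for j
  have r: "\<bar>d (Suc (Suc i))\<bar> = 2 * \<bar>\<alpha> * d (Suc i) + (1 - \<alpha>) * d i\<bar>" if "i < n" for i
    unfolding d_def by (rule displacement_rec) (rule same[OF that])
  have lin: "\<alpha> * d (Suc i) + (1 - \<alpha>) * d i = side_form \<alpha> ((G ^^ i) z) - side_form \<alpha> ((G ^^ i) z')" for i
    by (simp add: d_def coordinates_G side_form_def algebra_simps)
  have l0: "\<alpha> * d 1 + (1 - \<alpha>) * d 0 = 0" using lin[of 0] z by simp
  have ln: "\<alpha> * d (Suc n) + (1 - \<alpha>) * d n = 0" using lin[of n] ret by simp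
  have d2: "d 2 = 0" using r[of 0] \<open>0 < n\<close> l0 by (simp add: numeral_2_eq_2)
  have "d 1 = 0"
  proof (rule ccontr)
    assume d1: "d 1 \<noteq> 0"
    have "n \<noteq> 1" using ln d2 d1 less_1 by (auto simp: numeral_2_eq_2)
    then have "2 \<le> n" using \<open>0 < n\<close> by simp
    have "\<bar>d i\<bar> \<le> \<bar>d (Suc i)\<bar> \<and> d (Suc i) \<noteq> 0" if "2 \<le> i" "i \<le> n" for i
      using that
    proof (induction i rule: dec_induct)
      case base
      then show ?case using r[of 1] d1 d2 \<open>2 \<le> n\<close> less_1 by (auto simp: numeral_2_eq_2 abs_mult)
    next
      case (step i)
      have "2 * \<alpha> * \<bar>d (Suc i)\<bar> - 2 * (1 - \<alpha>) * \<bar>d i\<bar> \<le> \<bar>d (Suc (Suc i))\<bar>"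
        using r[of i] step abs_combination_ge[of "d (Suc i)" "d i"] by simp
      moreover have "2 * (1 - \<alpha>) * \<bar>d i\<bar> \<le> 2 * (1 - \<alpha>) * \<bar>d (Suc i)\<bar>"
        using step less_1 by (intro mult_left_mono) auto
      moreover have "1 * \<bar>d (Suc i)\<bar> \<le> (4 * \<alpha> - 2) * \<bar>d (Suc i)\<bar>"
        using steep by (intro mult_right_mono) auto
      ultimately have "\<bar>d (Suc i)\<bar> \<le> \<bar>d (Suc (Suc i))\<bar>" by (simp add: algebra_simps)
      then show ?case using step by auto
    qed
    from this[of n] have dn: "\<bar>d n\<bar> \<le> \<bar>d (Suc n)\<bar>" "d (Suc n) \<noteq> 0" using \<open>2 \<le> n\<close> by auto
    have "\<alpha> * \<bar>d (Suc n)\<bar> = (1 - \<alpha>) * \<bar>d n\<bar>"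
    proof -
      have "\<alpha> * d (Suc n) = - ((1 - \<alpha>) * d n)" using ln by linarith
      then have "\<bar>\<alpha> * d (Suc n)\<bar> = \<bar>(1 - \<alpha>) * d n\<bar>" by simp
      then show ?thesis using steep less_1 by (simp add: abs_mult)
    qed
    also have "\<dots> \<le> (1 - \<alpha>) * \<bar>d (Suc n)\<bar>" using dn less_1 by (intro mult_left_mono) auto
    also have "\<dots> < \<alpha> * \<bar>d (Suc n)\<bar>" using dn steep by (intro mult_strict_right_mono) auto
    finally show False by simp
  qed
  with l0 less_1 have "d 0 = 0" "d 1 = 0" by auto
  then show ?thesis by (simp add: d_def prod_eq_iff coordinates_G)
qed

lemma countable_returns:
  "countable {z. side_form \<alpha> z = 1/2 \<and> (\<exists>n>0. side_form \<alpha> ((G ^^ n) z) = 1/2)}"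
proof -
  define R where "R n = {z. side_form \<alpha> z = 1/2 \<and> side_form \<alpha> ((G ^^ n) z) = 1/2}" for n
  have "countable (R n)" if "0 < n" for n
  proof (rule countable_image_inj_on)
    show "inj_on (\<lambda>z. map (\<lambda>i. upper \<alpha> i z) [0..<n]) (R n)"
    proof (rule inj_onI)
      fix z z' assume "z \<in> R n" "z' \<in> R n" "map (\<lambda>i. upper \<alpha> i z) [0..<n] = map (\<lambda>i. upper \<alpha> i z') [0..<n]"
      then show "z = z'" using that by (intro return_unique[of z z' n]) (auto simp: R_def)
    qed
  qed simp
  then have "countable (\<Union>n\<in>{0<..}. R n)" by (intro countable_UN) auto
  moreover have "(\<Union>n\<in>{0<..}. R n) = {z. side_form \<alpha> z = 1/2 \<and> (\<exists>n>0. side_form \<alpha> ((G ^^ n) z) = 1/2)}"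
    by (auto simp: R_def)
  ultimately show ?thesis by simp
qed

section \<open>Stable sets have area zero\<close>

text \<open>Each branch of \<open>G\<close> is the exchange of the two coordinates followed by a shear and a scaling in one
  variable, so its Jacobian can be computed by Fubini's theorem.\<close>

lemma area_affine_branch:
  fixes s c :: real
  assumes "s \<noteq> 0" and B [measurable]: "B \<in> sets borel"
  defines "f \<equiv> \<lambda>p. (snd p, s * side_form \<alpha> p + c)"
  shows "ennreal (\<bar>s\<bar> * (1 - \<alpha>)) * emeasure lborel (f -` B) = emeasure lborel B"
proof -
  have f [measurable]: "f \<in> borel_measurable borel"
    unfolding f_def side_form_def by (intro borel_measurable_continuous_onI continuous_intros)
  have B': "B \<in> sets (lborel \<Otimes>\<^sub>M lborel)" using B unfolding lborel_prod by simp
  have fB: "f -` B \<in> sets (lborel \<Otimes>\<^sub>M lborel)"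
    using measurable_sets_borel[OF f B] unfolding lborel_prod by simp
  have "emeasure lborel B = (\<integral>\<^sup>+ y. emeasure lborel (Pair y -` B) \<partial>lborel)"
    using lborel.emeasure_pair_measure_alt[OF B'] by (simp add: lborel_prod)
  also have "\<dots> = (\<integral>\<^sup>+ y. ennreal (\<bar>s\<bar> * (1 - \<alpha>)) * emeasure lborel ((\<lambda>x. (x, y)) -` (f -` B)) \<partial>lborel)"
  proof (rule nn_integral_cong)
    fix y :: real
    have m1: "Pair y -` B \<in> sets lborel" using sets_Pair1[OF B'] by simp
    have m2: "(\<lambda>x. (x, y)) -` (f -` B) \<in> sets lborel" using sets_Pair2[OF fB] by simp
    have "emeasure lborel (Pair y -` B) = (\<integral>\<^sup>+ u. indicator (Pair y -` B) u \<partial>lborel)"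
      using m1 by (simp add: nn_integral_indicator)
    also have "\<dots> = ennreal \<bar>s * (1 - \<alpha>)\<bar> *
        (\<integral>\<^sup>+ x. indicator (Pair y -` B) ((s * \<alpha> * y + c) + (s * (1 - \<alpha>)) * x) \<partial>lborel)"
      using m1 assms(1) less_1 by (intro nn_integral_real_affine) auto
    also have "(\<integral>\<^sup>+ x. indicator (Pair y -` B) ((s * \<alpha> * y + c) + (s * (1 - \<alpha>)) * x) \<partial>lborel)
        = (\<integral>\<^sup>+ x. indicator ((\<lambda>x. (x, y)) -` (f -` B)) x \<partial>lborel)"
      by (intro nn_integral_cong) (auto simp: f_def side_form_def indicator_def algebra_simps)
    also have "\<dots> = emeasure lborel ((\<lambda>x. (x, y)) -` (f -` B))"
      using m2 by (simp add: nn_integral_indicator)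
    finally show "emeasure lborel (Pair y -` B) = ennreal (\<bar>s\<bar> * (1 - \<alpha>)) * emeasure lborel ((\<lambda>x. (x, y)) -` (f -` B))"
      using less_1 by (simp add: abs_mult)
  qed
  also have "\<dots> = ennreal (\<bar>s\<bar> * (1 - \<alpha>)) * (\<integral>\<^sup>+ y. emeasure lborel ((\<lambda>x. (x, y)) -` (f -` B)) \<partial>lborel)"
    by (intro nn_integral_cmult lborel_pair.measurable_emeasure_Pair2 fB)
  also have "(\<integral>\<^sup>+ y. emeasure lborel ((\<lambda>x. (x, y)) -` (f -` B)) \<partial>lborel) = emeasure lborel (f -` B)"
    using lborel_pair.emeasure_pair_measure_alt2[OF fB] by (simp add: lborel_prod)
  finally show ?thesis ..
qed

lemma continuous_G: "continuous_on UNIV G"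
  unfolding G_map_def tent_def split_beta by (intro continuous_intros)

lemma borel_measurable_G [measurable]: "G \<in> borel_measurable borel"
  by (intro borel_measurable_continuous_onI continuous_G)

lemma continuous_G_funpow: "continuous_on UNIV (G ^^ n)"
proof (induction n)
  case (Suc n)
  then show ?case
    using continuous_on_compose2[OF continuous_G Suc subset_UNIV] by (simp add: o_def)
qed (simp add: continuous_on_id id_def)

lemma borel_measurable_G_funpow [measurable]: "(G ^^ n) \<in> borel_measurable borel"
  by (intro borel_measurable_continuous_onI continuous_G_funpow)

lemma area_vimage_G_le:
  assumes B: "B \<in> sets borel"
  shows "emeasure lborel (G -` B) \<le> ennreal (1 / (1 - \<alpha>)) * emeasure lborel B"
proof -
  define f where "f s c p = (snd p, s * side_form \<alpha> p + c)" for s c :: real and p :: "real \<times> real"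
  have fm: "f s c \<in> borel_measurable borel" for s c
    unfolding f_def side_form_def by (intro borel_measurable_continuous_onI continuous_intros)
  have br: "emeasure lborel (f s c -` B) = ennreal (1 / (2 * (1 - \<alpha>))) * emeasure lborel B"
    if "\<bar>s\<bar> = 2" for s c
  proof -
    have "ennreal (2 * (1 - \<alpha>)) * emeasure lborel (f s c -` B) = emeasure lborel B"
      using area_affine_branch[of s B c] that B unfolding f_def by auto
    then have "ennreal (1 / (2 * (1 - \<alpha>))) * emeasure lborel B =
       (ennreal (1 / (2 * (1 - \<alpha>))) * ennreal (2 * (1 - \<alpha>))) * emeasure lborel (f s c -` B)"
      by (simp add: mult.assoc)
    also have "ennreal (1 / (2 * (1 - \<alpha>))) * ennreal (2 * (1 - \<alpha>)) = 1"
      using less_1 by (subst ennreal_mult[symmetric]) auto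
    finally show ?thesis by simp
  qed
  have sub: "G -` B \<subseteq> f 2 0 -` B \<union> f (- 2) 2 -` B"
  proof
    fix p assume p: "p \<in> G -` B"
    have "G p = f 2 0 p \<or> G p = f (- 2) 2 p"
      by (cases p) (auto simp: f_def G_map_def tent_def side_form_def abs_if)
    then show "p \<in> f 2 0 -` B \<union> f (- 2) 2 -` B" using p by auto
  qed
  have ms: "f s c -` B \<in> sets lborel" for s c using measurable_sets_borel[OF fm B] by simp
  have "emeasure lborel (G -` B) \<le> emeasure lborel (f 2 0 -` B \<union> f (- 2) 2 -` B)"
    by (rule emeasure_mono[OF sub]) (use ms in auto)
  also have "\<dots> \<le> emeasure lborel (f 2 0 -` B) + emeasure lborel (f (- 2) 2 -` B)"
    by (rule emeasure_subadditive) (use ms in auto)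
  also have "\<dots> = (ennreal (1 / (2 * (1 - \<alpha>))) + ennreal (1 / (2 * (1 - \<alpha>)))) * emeasure lborel B"
    by (simp add: br distrib_right)
  also have "ennreal (1 / (2 * (1 - \<alpha>))) + ennreal (1 / (2 * (1 - \<alpha>))) = ennreal (1 / (1 - \<alpha>))"
    using less_1 by (subst ennreal_plus[symmetric]) (auto simp: field_simps)
  finally show ?thesis .
qed

lemma area_vimage_funpow_le:
  assumes "B \<in> sets borel"
  shows "emeasure lborel ((G ^^ n) -` B) \<le> ennreal ((1 / (1 - \<alpha>)) ^ n) * emeasure lborel B"
  using assms
proof (induction n arbitrary: B)
  case (Suc n)
  have "(G ^^ Suc n) -` B = (G ^^ n) -` (G -` B)" by auto
  then have "emeasure lborel ((G ^^ Suc n) -` B) \<le> ennreal ((1 / (1 - \<alpha>)) ^ n) * emeasure lborel (G -` B)"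
    using Suc.IH[of "G -` B"] measurable_sets_borel[OF borel_measurable_G Suc.prems] by simp
  also have "\<dots> \<le> ennreal ((1 / (1 - \<alpha>)) ^ n) * (ennreal (1 / (1 - \<alpha>)) * emeasure lborel B)"
    by (intro mult_left_mono area_vimage_G_le Suc.prems) auto
  also have "\<dots> = ennreal ((1 / (1 - \<alpha>)) ^ Suc n) * emeasure lborel B"
    using less_1 by (simp only: mult.assoc[symmetric] power_Suc2 ennreal_mult zero_le_power zero_le_divide_1_iff diff_ge_0_iff_ge less_imp_le)
  finally show ?case .
qed simp

lemma area_cball_le:
  fixes z :: "real \<times> real"
  assumes "0 \<le> r"
  shows "emeasure lborel (cball z r) \<le> ennreal (4 * r\<^sup>2)"
proof -
  have "cball z r \<subseteq> {fst z - r..fst z + r} \<times> {snd z - r..snd z + r}"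
  proof
    fix p assume "p \<in> cball z r"
    then have "dist (fst z) (fst p) \<le> r" "dist (snd z) (snd p) \<le> r"
      using dist_fst_le[of z p] dist_snd_le[of z p] by auto
    then show "p \<in> {fst z - r..fst z + r} \<times> {snd z - r..snd z + r}"
      by (auto simp: mem_Times_iff dist_real_def)
  qed
  then have "emeasure lborel (cball z r) \<le>
      emeasure (lborel \<Otimes>\<^sub>M lborel) ({fst z - r..fst z + r} \<times> {snd z - r..snd z + r})"
    unfolding lborel_prod by (intro emeasure_mono) (auto intro!: borel_closed closed_Times)
  also have "\<dots> = ennreal (2 * r) * ennreal (2 * r)"
    using assms by (subst lborel.emeasure_pair_measure_Times) auto
  also have "\<dots> = ennreal (4 * r\<^sup>2)"
    using assms by (subst ennreal_mult[symmetric]) (auto simp: power2_eq_square)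
  finally show ?thesis .
qed

text \<open>The \<open>n\<close>-th preimage of a ball of radius \<open>2 \<lambda>\<^sub>1\<^sup>n\<close> has area at most \<open>16 (\<lambda>\<^sub>1\<^sup>2/(1 - \<alpha>))\<^sup>n\<close>, and
  \<open>\<lambda>\<^sub>1\<^sup>2/(1 - \<alpha>) = 2 \<lambda>\<^sub>1/\<lambda>\<^sub>2 < 1\<close>.\<close>

lemma stable_set_null:
  fixes z :: "nat \<Rightarrow> real \<times> real"
  shows "{p. \<forall>n. dist ((G ^^ n) p) (z n) \<le> 2 * contr ^ n} \<in> null_sets lborel"
proof -
  define A where "A = {p. \<forall>n. dist ((G ^^ n) p) (z n) \<le> 2 * contr ^ n}"
  have "A = (\<Inter>n. (G ^^ n) -` cball (z n) (2 * contr ^ n))"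
    by (auto simp: A_def dist_commute)
  moreover have "(G ^^ n) -` cball (z n) (2 * contr ^ n) \<in> sets borel" for n
    by (rule measurable_sets_borel[OF borel_measurable_G_funpow]) auto
  ultimately have A: "A \<in> sets lborel" by auto
  define \<theta> where "\<theta> = contr\<^sup>2 / (1 - \<alpha>)"
  have th: "0 \<le> \<theta>" "\<theta> < 1"
  proof -
    show "0 \<le> \<theta>" using less_1 by (simp add: \<theta>_def)
    have "contr\<^sup>2 * 2 < contr * expan"
      using mult_strict_left_mono[of "contr * 2" expan contr] rates(3-5) by (simp add: power2_eq_square)
    then show "\<theta> < 1" using less_1 by (simp add: \<theta>_def rates(2))
  qed
  have le: "emeasure lborel A \<le> ennreal (16 * \<theta> ^ n)" for n
  proof -
    have "emeasure lborel A \<le> emeasure lborel ((G ^^ n) -` cball (z n) (2 * contr ^ n))"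
    proof (rule emeasure_mono)
      show "A \<subseteq> (G ^^ n) -` cball (z n) (2 * contr ^ n)" by (auto simp: A_def dist_commute)
    qed (use measurable_sets_borel[OF borel_measurable_G_funpow] in auto)
    also have "\<dots> \<le> ennreal ((1 / (1 - \<alpha>)) ^ n) * emeasure lborel (cball (z n) (2 * contr ^ n))"
      by (intro area_vimage_funpow_le) auto
    also have "\<dots> \<le> ennreal ((1 / (1 - \<alpha>)) ^ n) * ennreal (4 * (2 * contr ^ n)\<^sup>2)"
      using rates by (intro mult_left_mono area_cball_le) auto
    also have "\<dots> = ennreal (16 * \<theta> ^ n)"
      using less_1 by (subst ennreal_mult[symmetric])
        (auto simp: \<theta>_def power_divide power_mult_distrib power_mult[symmetric] mult.commute rates(3) less_imp_le)
    finally show ?thesis .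
  qed
  have "(\<lambda>n. ennreal (16 * \<theta> ^ n)) \<longlonglongrightarrow> ennreal (16 * 0)"
    using th by (intro tendsto_ennrealI tendsto_intros LIMSEQ_realpow_zero) auto
  then have "emeasure lborel A \<le> ennreal (16 * 0)"
    using le by (intro LIMSEQ_le_const[of "\<lambda>n. ennreal (16 * \<theta> ^ n)"]) auto
  then show ?thesis using A by (auto simp: A_def null_sets_def)
qed

end

section \<open>The point with a given two-sided itinerary\<close>

abbreviation seq_space :: "('i \<Rightarrow> real) measure" where
  "seq_space \<equiv> PiM UNIV (\<lambda>_. borel)"

lemma measurable_word [measurable]:
  assumes "\<And>x. x \<in> set xs \<Longrightarrow> Measurable.pred N (f x)"
  shows "(\<lambda>\<omega>. map (\<lambda>x. f x \<omega>) xs) \<in> N \<rightarrow>\<^sub>M count_space (UNIV :: bool list set)"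
  using assms
proof (induction xs)
  case (Cons x xs)
  have [measurable]: "Measurable.pred N (f x)"
    "(\<lambda>\<omega>. map (\<lambda>x. f x \<omega>) xs) \<in> N \<rightarrow>\<^sub>M count_space UNIV"
    using Cons by auto
  show ?case
  proof (subst measurable_count_space_eq2_countable, intro conjI ballI)
    fix w :: "bool list"
    show "(\<lambda>\<omega>. map (\<lambda>x. f x \<omega>) (x # xs)) -` {w} \<inter> space N \<in> sets N"
    proof (cases w)
      case (Cons b bs)
      have "(\<lambda>\<omega>. map (\<lambda>x. f x \<omega>) (x # xs)) -` {w} \<inter> space N
          = {\<omega> \<in> space N. f x \<omega> = b} \<inter> {\<omega> \<in> space N. map (\<lambda>x. f x \<omega>) xs = bs}"
        by (auto simp: Cons)
      also have "\<dots> \<in> sets N" by measurable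
      finally show ?thesis .
    qed simp
  qed auto
qed simp

context steep
begin

text \<open>The symbols are real numbers because Kolmogorov's extension theorem is applied to them; in a
  sequence \<open>\<omega>\<close> the value \<open>1\<close> stands for the upper side.\<close>

definition itinerary :: "real \<times> real \<Rightarrow> nat \<Rightarrow> real" where
  "itinerary p i = of_bool (upper \<alpha> i p)"

lemma measurable_upper [measurable]: "Measurable.pred borel (upper \<alpha> i)"
proof -
  have [measurable]: "side_form \<alpha> \<in> borel_measurable borel"
    unfolding side_form_def by (intro borel_measurable_continuous_onI continuous_intros)
  show ?thesis unfolding upper_def by measurable
qed

lemma measurable_itinerary [measurable]: "itinerary \<in> borel \<rightarrow>\<^sub>M seq_space"
  by (rule measurable_PiM_single') (auto simp: itinerary_def)

lemma upper_funpow: "upper \<alpha> i ((G ^^ j) p) = upper \<alpha> (i + j) p"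
  by (simp add: upper_def funpow_add)

lemma upper_G: "upper \<alpha> i (G p) = upper \<alpha> (Suc i) p"
  using upper_funpow[of i 1 p] by simp

text \<open>Every finite window of \<open>\<omega>\<close> is the initial word of the itinerary of a point of the square. Almost
  every sequence of the natural extension has this property.\<close>

definition realizable :: "(int \<Rightarrow> real) \<Rightarrow> bool" where
  "realizable \<omega> \<longleftrightarrow> (\<forall>N m. \<exists>p\<in>unit_square. \<forall>i<m. upper \<alpha> i p \<longleftrightarrow> \<omega> (int i - int N) = 1)"

definition pick :: "nat \<Rightarrow> (int \<Rightarrow> real) \<Rightarrow> real \<times> real" where
  "pick n \<omega> = (SOME p. p \<in> unit_square \<and> (\<forall>i<Suc (2 * n). upper \<alpha> i p \<longleftrightarrow> \<omega> (int i - int n) = 1))"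

definition limit_point :: "(int \<Rightarrow> real) \<Rightarrow> real \<times> real" where
  "limit_point \<omega> = lim (\<lambda>n. (G ^^ n) (pick n \<omega>))"

text \<open>Although it is chosen arbitrarily, \<open>pick n \<omega>\<close> depends only on a finite word over a finite
  alphabet.\<close>

lemma measurable_pick [measurable]: "pick n \<in> seq_space \<rightarrow>\<^sub>M borel"
proof -
  define h where "h w = (SOME p. p \<in> unit_square \<and> (\<forall>i<length w. upper \<alpha> i p \<longleftrightarrow> w ! i))" for w
  have "pick n \<omega> = h (map (\<lambda>i. \<omega> (int i - int n) = 1) [0..<Suc (2 * n)])" for \<omega>
    unfolding pick_def h_def by (rule arg_cong[where f = Eps]) (auto simp del: upt_Suc)
  then have "pick n = h \<circ> (\<lambda>\<omega>. map (\<lambda>i. \<omega> (int i - int n) = 1) [0..<Suc (2 * n)])"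
    by (simp add: fun_eq_iff)
  moreover have "(\<lambda>\<omega>. map (\<lambda>i. \<omega> (int i - int n) = 1) [0..<Suc (2 * n)]) \<in> seq_space \<rightarrow>\<^sub>M count_space UNIV"
    by (rule measurable_word) measurable
  ultimately show ?thesis
    using measurable_comp[of _ seq_space "count_space UNIV" h borel] by (simp del: upt_Suc)
qed

lemma measurable_limit_point [measurable]: "limit_point \<in> seq_space \<rightarrow>\<^sub>M borel"
  unfolding limit_point_def by measurable

lemma pick:
  assumes "realizable \<omega>"
  shows "pick n \<omega> \<in> unit_square" and "i < Suc (2 * n) \<Longrightarrow> upper \<alpha> i (pick n \<omega>) \<longleftrightarrow> \<omega> (int i - int n) = 1"
proof -
  have "\<exists>p. p \<in> unit_square \<and> (\<forall>i<Suc (2 * n). upper \<alpha> i p \<longleftrightarrow> \<omega> (int i - int n) = 1)"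
    using assms unfolding realizable_def by blast
  from someI_ex[OF this] show "pick n \<omega> \<in> unit_square"
    "i < Suc (2 * n) \<Longrightarrow> upper \<alpha> i (pick n \<omega>) \<longleftrightarrow> \<omega> (int i - int n) = 1"
    unfolding pick_def[symmetric] by auto
qed

text \<open>Iterating \<open>pick m \<omega>\<close> for \<open>m - N\<close> steps yields a point that follows the same symbols as \<open>q\<close>, so the
  contraction estimate compares \<open>q\<close> with all later approximants at once. Both the convergence and the
  equivariance of the limit rest on it.\<close>

lemma dist_approximant_le:
  assumes \<omega>: "realizable \<omega>" and q: "q \<in> unit_square"
    and upper: "\<And>i. i < N + k \<Longrightarrow> upper \<alpha> i q \<longleftrightarrow> \<omega> (int i - int N) = 1"
    and m: "N \<le> m" "k \<le> m"
  shows "dist ((G ^^ N) q) ((G ^^ m) (pick m \<omega>)) \<le> orbit_bound N (N + k)"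
proof -
  let ?r = "(G ^^ (m - N)) (pick m \<omega>)"
  have "dist ((G ^^ N) q) ((G ^^ N) ?r) \<le> orbit_bound N (N + k)"
  proof (rule dist_iterates_le[OF q])
    fix i assume i: "i < N + k"
    have "upper \<alpha> i ?r \<longleftrightarrow> \<omega> (int (i + (m - N)) - int m) = 1"
      using i m by (simp add: upper_funpow pick(2)[OF \<omega>])
    also have "int (i + (m - N)) - int m = int i - int N" using m by simp
    finally show "upper \<alpha> i q = upper \<alpha> i ?r" using upper[OF i] by simp
  qed (use G_square pick(1)[OF \<omega>] in auto)
  moreover have "(G ^^ N) ?r = (G ^^ m) (pick m \<omega>)"
    using m by (metis comp_apply funpow_add le_add_diff_inverse)
  ultimately show ?thesis by simp
qed

lemma orbit_bound_tendsto_0: "(\<lambda>n. orbit_bound n (n + n)) \<longlonglongrightarrow> 0"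
proof -
  have "(\<lambda>n. 2 * contr ^ n + 4 * (1 / expan) ^ n) \<longlonglongrightarrow> 2 * 0 + 4 * 0"
    using rates by (intro tendsto_intros LIMSEQ_realpow_zero) auto
  then show ?thesis by (simp add: orbit_bound_def)
qed

lemma approximants_tendsto:
  assumes \<omega>: "realizable \<omega>"
  shows "(\<lambda>n. (G ^^ n) (pick n \<omega>)) \<longlonglongrightarrow> limit_point \<omega>"
proof -
  have "Cauchy (\<lambda>n. (G ^^ n) (pick n \<omega>))"
  proof (rule metric_CauchyI)
    fix \<epsilon> :: real assume "0 < \<epsilon>"
    then have "eventually (\<lambda>n. orbit_bound n (n + n) < \<epsilon> / 2) sequentially"
      using order_tendstoD(2)[OF orbit_bound_tendsto_0, of "\<epsilon> / 2"] by simp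
    then obtain M where M: "orbit_bound M (M + M) < \<epsilon> / 2" by (auto simp: eventually_sequentially)
    have "dist ((G ^^ M) (pick M \<omega>)) ((G ^^ m) (pick m \<omega>)) < \<epsilon> / 2" if "M \<le> m" for m
      using dist_approximant_le[OF \<omega> pick(1)[OF \<omega>] _ that that, of M] pick(2)[OF \<omega>, of _ M] M by auto
    then show "\<exists>M. \<forall>m\<ge>M. \<forall>n\<ge>M. dist ((G ^^ m) (pick m \<omega>)) ((G ^^ n) (pick n \<omega>)) < \<epsilon>"
      by (metis dist_triangle_half_r)
  qed
  then show ?thesis
    unfolding limit_point_def by (simp add: Cauchy_convergent convergent_LIMSEQ_iff[symmetric])
qed

lemma dist_limit_point_le:
  assumes \<omega>: "realizable \<omega>" and q: "q \<in> unit_square"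
    and upper: "\<And>i. i < N + k \<Longrightarrow> upper \<alpha> i q \<longleftrightarrow> \<omega> (int i - int N) = 1"
  shows "dist ((G ^^ N) q) (limit_point \<omega>) \<le> orbit_bound N (N + k)"
proof (rule Lim_dist_ubound[OF _ approximants_tendsto[OF \<omega>]])
  show "\<forall>\<^sub>F m in sequentially. dist ((G ^^ N) q) ((G ^^ m) (pick m \<omega>)) \<le> orbit_bound N (N + k)"
    using dist_approximant_le[OF \<omega> q upper]
    by (auto intro!: eventually_sequentiallyI[of "max N k"])
qed simp

lemma limit_point_in_square:
  assumes \<omega>: "realizable \<omega>"
  shows "limit_point \<omega> \<in> unit_square"
proof (rule closed_sequentially[OF _ _ approximants_tendsto[OF \<omega>]])
  show "closed unit_square" unfolding unit_square_def by (intro closed_Times) auto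
  show "(G ^^ n) (pick n \<omega>) \<in> unit_square" for n using G_square pick(1)[OF \<omega>] by auto
qed

lemma realizable_shift:
  assumes \<omega>: "realizable \<omega>"
  shows "realizable (\<lambda>i. \<omega> (i + 1))"
  unfolding realizable_def
proof (intro allI)
  fix N m
  obtain p where p: "p \<in> unit_square" "\<And>i. i < Suc m \<Longrightarrow> upper \<alpha> i p \<longleftrightarrow> \<omega> (int i - int N) = 1"
    using \<omega> unfolding realizable_def by blast
  have "upper \<alpha> i (G p) \<longleftrightarrow> \<omega> (int i - int N + 1) = 1" if "i < m" for i
    using p(2)[of "Suc i"] that by (simp add: upper_G algebra_simps)
  moreover have "G p \<in> unit_square" using G_square[OF p(1), of 1] by simp
  ultimately show "\<exists>p\<in>unit_square. \<forall>i<m. upper \<alpha> i p \<longleftrightarrow> \<omega> (int i - int N + 1) = 1" by blast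
qed

lemma limit_point_shift:
  assumes \<omega>: "realizable \<omega>"
  shows "limit_point (\<lambda>i. \<omega> (i + 1)) = G (limit_point \<omega>)"
proof (rule LIMSEQ_unique)
  let ?z = "\<lambda>n. G ((G ^^ n) (pick n \<omega>))"
  show "?z \<longlonglongrightarrow> G (limit_point \<omega>)"
    using continuous_on_tendsto_compose[OF continuous_G approximants_tendsto[OF \<omega>]] by simp
  have "dist (?z n) (limit_point (\<lambda>i. \<omega> (i + 1))) \<le> orbit_bound n (n + n)" for n
  proof -
    have "dist ((G ^^ n) (G (pick n \<omega>))) (limit_point (\<lambda>i. \<omega> (i + 1))) \<le> orbit_bound n (n + n)"
    proof (rule dist_limit_point_le[OF realizable_shift[OF \<omega>]])
      show "G (pick n \<omega>) \<in> unit_square" using G_square[OF pick(1)[OF \<omega>], of 1] by simp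
      show "upper \<alpha> i (G (pick n \<omega>)) \<longleftrightarrow> \<omega> (int i - int n + 1) = 1" if "i < n + n" for i
        using that pick(2)[OF \<omega>, of "Suc i" n] by (simp add: upper_G algebra_simps)
    qed
    then show ?thesis by (simp add: funpow_swap1)
  qed
  then have "(\<lambda>n. dist (?z n) (limit_point (\<lambda>i. \<omega> (i + 1)))) \<longlonglongrightarrow> 0"
    by (intro tendsto_sandwich[OF _ _ tendsto_const orbit_bound_tendsto_0]) auto
  then show "?z \<longlonglongrightarrow> limit_point (\<lambda>i. \<omega> (i + 1))"
    by (rule iffD2[OF tendsto_dist_iff])
qed

lemma limit_point_shift_funpow:
  assumes \<omega>: "realizable \<omega>"
  shows "realizable (\<lambda>i. \<omega> (i + int k))" "limit_point (\<lambda>i. \<omega> (i + int k)) = (G ^^ k) (limit_point \<omega>)"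
proof (induction k)
  case 0
  { case 1 then show ?case using \<omega> by simp next case 2 then show ?case by simp }
next
  case (Suc k)
  have s: "(\<lambda>i. \<omega> (i + int (Suc k))) = (\<lambda>i. (\<lambda>i. \<omega> (i + int k)) (i + 1))"
    by (simp add: algebra_simps)
  { case 1 then show ?case unfolding s using realizable_shift[OF Suc.IH(1)] by simp
  next case 2 then show ?case unfolding s limit_point_shift[OF Suc.IH(1)] by (simp add: Suc.IH(2)) }
qed

lemma continuous_side_form: "continuous_on UNIV (side_form \<alpha>)"
  unfolding side_form_def by (intro continuous_intros)

text \<open>The side of the fold line is locally constant away from the line. On the line the conclusion may
  fail, and this is the only obstruction to \<open>limit_point \<omega>\<close> having the future itinerary of \<open>\<omega>\<close>.\<close>

lemma upper_0_limit_point: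
  assumes \<omega>: "realizable \<omega>" and off: "side_form \<alpha> (limit_point \<omega>) \<noteq> 1/2"
  shows "upper \<alpha> 0 (limit_point \<omega>) \<longleftrightarrow> \<omega> 0 = 1"
proof -
  let ?z = "\<lambda>n. (G ^^ n) (pick n \<omega>)"
  have lim: "(\<lambda>n. side_form \<alpha> (?z n)) \<longlonglongrightarrow> side_form \<alpha> (limit_point \<omega>)"
    using continuous_on_tendsto_compose[OF continuous_side_form approximants_tendsto[OF \<omega>]] by simp
  have sym: "1/2 < side_form \<alpha> (?z n) \<longleftrightarrow> \<omega> 0 = 1" for n
    using pick(2)[OF \<omega>, of n n] by (simp add: upper_def)
  show ?thesis
  proof (cases "\<omega> 0 = 1")
    case True
    then have "1/2 \<le> side_form \<alpha> (limit_point \<omega>)"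
      using sym by (intro LIMSEQ_le_const[OF lim]) (auto intro: less_imp_le)
    with True off show ?thesis by (simp add: upper_def)
  next
    case False
    then have "side_form \<alpha> (limit_point \<omega>) \<le> 1/2"
      using sym by (intro LIMSEQ_le_const2[OF lim]) (auto simp: not_less)
    with False show ?thesis by (simp add: upper_def)
  qed
qed

lemma dist_iterates_limit_point_le:
  assumes \<omega>: "realizable \<omega>" and q: "q \<in> unit_square"
    and upper: "\<And>i. i < k \<Longrightarrow> upper \<alpha> i q \<longleftrightarrow> \<omega> (int i) = 1" and "n \<le> k"
  shows "dist ((G ^^ n) q) ((G ^^ n) (limit_point \<omega>)) \<le> orbit_bound n k"
proof (rule Lim_dist_ubound)
  let ?z = "\<lambda>m. (G ^^ m) (pick m \<omega>)"
  show "(\<lambda>m. (G ^^ n) (?z m)) \<longlonglongrightarrow> (G ^^ n) (limit_point \<omega>)"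
    using continuous_on_tendsto_compose[OF continuous_G_funpow approximants_tendsto[OF \<omega>]] by simp
  have "dist ((G ^^ n) q) ((G ^^ n) (?z m)) \<le> orbit_bound n k" if "k \<le> m" for m
  proof (rule dist_iterates_le[OF q _ _ \<open>n \<le> k\<close>])
    show "?z m \<in> unit_square" using G_square pick(1)[OF \<omega>] by auto
    show "upper \<alpha> i q = upper \<alpha> i (?z m)" if "i < k" for i
      using that \<open>k \<le> m\<close> by (simp add: upper_funpow upper pick(2)[OF \<omega>])
  qed
  then show "\<forall>\<^sub>F m in sequentially. dist ((G ^^ n) q) ((G ^^ n) (?z m)) \<le> orbit_bound n k"
    by (auto intro: eventually_sequentiallyI)
qed simp

end

section \<open>The invariant measure on the square\<close>

lemma (in prob_space) prob_eq_0_if_disjoint_and_equal: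
  assumes A: "range A \<subseteq> events" "disjoint_family (A :: nat \<Rightarrow> _)" and eq: "\<And>n. prob (A n) = prob (A 0)"
  shows "prob (A 0) = 0"
proof -
  have "(\<lambda>n. prob (A n)) sums prob (\<Union>n. A n)" using A by (rule finite_measure_UNION)
  then have "summable (\<lambda>n. prob (A 0))" using eq by (metis sums_summable sums_cong)
  then show ?thesis by (simp add: summable_const_iff)
qed

context steep
begin

lemma measurable_prefix:
  "Measurable.pred seq_space (\<lambda>\<eta>. F (map (\<lambda>i. \<eta> i = (1::real)) [0..<(k::nat)]))"
proof -
  have "(\<lambda>\<eta>. map (\<lambda>i. \<eta> i = (1::real)) [0..<k]) \<in> (seq_space :: (nat \<Rightarrow> real) measure) \<rightarrow>\<^sub>M count_space UNIV"
    by (rule measurable_word) measurable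
  from measurable_compose[OF this, of F "count_space UNIV"] show ?thesis by simp
qed

lemma measurable_realized_prefix [measurable]:
  "Measurable.pred seq_space (\<lambda>\<eta>. \<exists>p\<in>unit_square. \<forall>i<k. upper \<alpha> i p \<longleftrightarrow> \<eta> i = 1)"
proof -
  define F where "F w \<longleftrightarrow> (\<exists>p\<in>unit_square. \<forall>i<k. upper \<alpha> i p \<longleftrightarrow> w ! i)" for w
  have "(\<lambda>\<eta>. \<exists>p\<in>unit_square. \<forall>i<k. upper \<alpha> i p \<longleftrightarrow> \<eta> i = (1::real)) = (\<lambda>\<eta>. F (map (\<lambda>i. \<eta> i = 1) [0..<k]))"
    by (simp add: fun_eq_iff F_def)
  then show ?thesis using measurable_prefix[of F k] by simp
qed

text \<open>If \<open>\<omega>\<close> has limit point \<open>z\<close>, then its future shadows \<open>z\<close>. Unlike the event that \<open>z\<close> is the limit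
  point, shadowing is a condition on the future alone, so that its probability can be
  computed in the square, where it describes a subset of a stable set.\<close>

definition shadows :: "real \<times> real \<Rightarrow> (nat \<Rightarrow> real) \<Rightarrow> bool" where
  "shadows z \<eta> \<longleftrightarrow> (\<forall>k n. n \<le> k \<longrightarrow> (\<forall>q\<in>unit_square. (\<forall>i<k. upper \<alpha> i q \<longleftrightarrow> \<eta> i = 1) \<longrightarrow>
      dist ((G ^^ n) q) ((G ^^ n) z) \<le> orbit_bound n k))"

lemma measurable_shadows [measurable]: "Measurable.pred seq_space (shadows z)"
proof -
  define F where "F k n w \<longleftrightarrow> (\<forall>q\<in>unit_square. (\<forall>i<k. upper \<alpha> i q \<longleftrightarrow> w ! i) \<longrightarrow>
      dist ((G ^^ n) q) ((G ^^ n) z) \<le> orbit_bound n k)" for k n w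
  have "shadows z = (\<lambda>\<eta>. \<forall>k n. n \<le> k \<longrightarrow> F k n (map (\<lambda>i. \<eta> i = 1) [0..<k]))"
    by (simp add: fun_eq_iff shadows_def F_def)
  moreover have [measurable]: "Measurable.pred seq_space (\<lambda>\<eta>. F k n (map (\<lambda>i. \<eta> i = (1::real)) [0..<k]))" for k n
    by (rule measurable_prefix)
  ultimately show ?thesis by simp
qed

lemma shadows_itinerary_null:
  "{p \<in> unit_square. shadows z (itinerary p)} \<subseteq> {p. \<forall>n. dist ((G ^^ n) p) ((G ^^ n) z) \<le> 2 * contr ^ n}"
proof clarify
  fix p n assume p: "p \<in> unit_square" "shadows z (itinerary p)"
  have "dist ((G ^^ n) p) ((G ^^ n) z) \<le> orbit_bound n (n + j)" for j
    using p unfolding shadows_def by (auto simp: itinerary_def)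
  moreover have "(\<lambda>j. orbit_bound n (n + j)) \<longlonglongrightarrow> 2 * contr ^ n + 4 * 0"
    unfolding orbit_bound_def add_diff_cancel_left' using rates
    by (intro tendsto_intros LIMSEQ_realpow_zero) auto
  ultimately show "dist ((G ^^ n) p) ((G ^^ n) z) \<le> 2 * contr ^ n"
    by (intro LIMSEQ_le_const[where X = "\<lambda>j. orbit_bound n (n + j)"]) auto
qed

end

text \<open>An absolutely continuous probability on the square that looks invariant to an observer of
  itineraries: \<open>G\<close> may redistribute it along the fibers.\<close>

locale stationary_itinerary = steep + M: prob_space M for M :: "(real \<times> real) measure" +
  assumes sets_M [measurable_cong]: "sets M = sets borel"
    and in_square: "AE p in M. p \<in> unit_square"
    and abs_cont: "absolutely_continuous lborel M"
    and stationary: "distr M seq_space (\<lambda>p. itinerary (G p)) = distr M seq_space itinerary"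
begin

definition law :: "(nat \<Rightarrow> real) measure" where "law = distr M seq_space itinerary"

lemma measurable_itinerary_M [measurable]: "itinerary \<in> M \<rightarrow>\<^sub>M seq_space"
  using measurable_itinerary by (simp add: measurable_cong_sets[OF sets_M refl])

lemma sets_law [measurable_cong]: "sets law = sets seq_space"
  by (simp add: law_def)

lemma AE_law:
  assumes "Measurable.pred seq_space Q" and "AE p in M. Q (itinerary p)"
  shows "AE \<eta> in law. Q \<eta>"
  unfolding law_def using assms by (subst AE_distr_iff) (auto simp: pred_def)

lemma two_sided_law:
  obtains P :: "(int \<Rightarrow> real) measure" where "prob_space P" "sets P = sets seq_space"
    "\<And>N. distr P seq_space (\<lambda>\<omega> i. \<omega> (int i - int N)) = law"
    "distr P seq_space (\<lambda>\<omega> i. \<omega> (i + 1)) = P"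
proof (rule natural_extension)
  show "prob_space law" unfolding law_def by (rule M.prob_space_distr) simp
  show "sets law = sets seq_space" by (rule sets_law)
  have sh: "(\<lambda>\<eta> i. \<eta> (Suc i)) \<in> seq_space \<rightarrow>\<^sub>M (seq_space :: (nat \<Rightarrow> real) measure)"
    by (rule measurable_PiM_single') auto
  have "distr law seq_space (\<lambda>\<eta> i. \<eta> (Suc i)) = distr M seq_space (\<lambda>p i. itinerary p (Suc i))"
    unfolding law_def by (subst distr_distr[OF sh]) (simp_all add: o_def)
  also have "(\<lambda>p i. itinerary p (Suc i)) = (\<lambda>p. itinerary (G p))"
    by (simp add: itinerary_def upper_G fun_eq_iff)
  finally show "distr law seq_space (\<lambda>\<eta> i. \<eta> (Suc i)) = law"
    by (simp add: stationary law_def)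
qed (use that in blast)

text \<open>The law of the limit point under the natural extension. Invariance follows from
  equivariance, and the comparison of itineraries from the fact that the fold line has measure zero:
  atoms are excluded by the stable sets, and the rest of the line by recurrence.\<close>

lemma invariant_lift_exists:
  obtains \<mu> :: "(real \<times> real) measure" where "prob_space \<mu>" "sets \<mu> = sets borel"
    "AE z in \<mu>. z \<in> unit_square" "distr \<mu> borel G = \<mu>" "distr \<mu> seq_space itinerary = distr M seq_space itinerary"
proof -
  obtain P :: "(int \<Rightarrow> real) measure" where P: "prob_space P" "sets P = sets seq_space"
    and past: "\<And>N. distr P seq_space (\<lambda>\<omega> i. \<omega> (int i - int N)) = law"
    and shift: "distr P seq_space (\<lambda>\<omega> i. \<omega> (i + 1)) = P"
    by (rule two_sided_law) blast
  interpret P: prob_space P by fact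
  have [measurable_cong]: "sets P = sets seq_space" by fact
  have m_past: "(\<lambda>\<omega> i. \<omega> (int i - int N)) \<in> P \<rightarrow>\<^sub>M (seq_space :: (nat \<Rightarrow> real) measure)" for N
    by (rule measurable_PiM_single') auto
  have m_shift: "(\<lambda>\<omega> i. \<omega> (i + 1)) \<in> P \<rightarrow>\<^sub>M (seq_space :: (int \<Rightarrow> real) measure)"
    by (rule measurable_PiM_single') auto
  have AE_P: "AE \<omega> in P. Q (\<lambda>i. \<omega> (int i - int N))"
    if "Measurable.pred seq_space Q" "AE p in M. Q (itinerary p)" for Q N
    using AE_law[OF that] that(1) unfolding past[of N, symmetric]
    by (subst (asm) AE_distr_iff[OF m_past]) (auto simp: pred_def)
  have real: "AE \<omega> in P. realizable \<omega>"
    unfolding realizable_def AE_all_countable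
  proof (intro allI)
    fix N m :: nat
    have "AE p in M. \<exists>q\<in>unit_square. \<forall>i<m. upper \<alpha> i q \<longleftrightarrow> itinerary p i = 1"
      using in_square by eventually_elim (auto simp: itinerary_def)
    then show "AE \<omega> in P. \<exists>p\<in>unit_square. \<forall>i<m. upper \<alpha> i p \<longleftrightarrow> \<omega> (int i - int N) = 1"
      by (rule AE_P[OF measurable_realized_prefix])
  qed
  have m_lim [measurable]: "limit_point \<in> borel_measurable P"
    using measurable_limit_point by (simp add: measurable_cong_sets[OF P(2) refl])
  define \<mu> where "\<mu> = distr P borel limit_point"
  have sets_\<mu> [measurable_cong]: "sets \<mu> = sets borel" by (simp add: \<mu>_def)
  have space_\<mu>: "space \<mu> = UNIV" by (simp add: \<mu>_def)
  interpret \<mu>: prob_space \<mu> unfolding \<mu>_def by (rule P.prob_space_distr) simp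
  have sq: "unit_square \<in> sets borel"
    unfolding unit_square_def by (intro borel_closed closed_Times) auto
  have AE_\<mu>: "(AE z in \<mu>. Q z) \<longleftrightarrow> (AE \<omega> in P. Q (limit_point \<omega>))" if "Measurable.pred borel Q" for Q
    unfolding \<mu>_def using that by (subst AE_distr_iff) (auto simp: pred_def)
  have \<mu>_sq: "AE z in \<mu>. z \<in> unit_square"
    using real limit_point_in_square sq by (subst AE_\<mu>) (auto simp: pred_def)
  have m_G: "G \<in> borel_measurable \<mu>" by simp
  have inv: "distr \<mu> borel G = \<mu>"
  proof -
    have "distr \<mu> borel G = distr P borel (\<lambda>\<omega>. G (limit_point \<omega>))"
      unfolding \<mu>_def by (subst distr_distr) (auto simp: o_def)
    also have "\<dots> = distr P borel (\<lambda>\<omega>. limit_point (\<lambda>i. \<omega> (i + 1)))"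
    proof (rule distr_cong_AE)
      show "AE \<omega> in P. G (limit_point \<omega>) = limit_point (\<lambda>i. \<omega> (i + 1))"
        using real by eventually_elim (simp add: limit_point_shift)
      show "(\<lambda>\<omega>. limit_point (\<lambda>i. \<omega> (i + 1))) \<in> borel_measurable P"
        using measurable_compose[OF m_shift measurable_limit_point] by simp
    qed auto
    also have "\<dots> = distr (distr P seq_space (\<lambda>\<omega> i. \<omega> (i + 1))) borel limit_point"
      by (subst distr_distr[OF measurable_limit_point m_shift]) (simp add: o_def)
    finally show ?thesis by (simp add: shift \<mu>_def)
  qed
  have inv_n: "distr \<mu> borel (G ^^ n) = \<mu>" for n
  proof (induction n)
    case 0
    then show ?case by (simp add: distr_id2 sets_\<mu> id_def)
  next
    case (Suc n)
    have "distr \<mu> borel (G ^^ Suc n) = distr (distr \<mu> borel (G ^^ n)) borel G"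
      by (subst distr_distr) (auto simp: o_def)
    then show ?case by (simp only: Suc inv)
  qed
  \<comment> \<open>The future of a sequence with limit point \<open>z\<close> shadows \<open>z\<close>, an event that is null in the square.\<close>
  have no_atom: "AE x in \<mu>. x \<noteq> z" for z
  proof -
    have "{p. \<forall>n. dist ((G ^^ n) p) ((G ^^ n) z) \<le> 2 * contr ^ n} \<in> null_sets M"
      using abs_cont stable_set_null[of "\<lambda>n. (G ^^ n) z"] unfolding absolutely_continuous_def by blast
    then have "AE p in M. p \<notin> {p. \<forall>n. dist ((G ^^ n) p) ((G ^^ n) z) \<le> 2 * contr ^ n}"
      by (rule AE_not_in)
    then have "AE p in M. \<not> shadows z (itinerary p)"
      using in_square by eventually_elim (use shadows_itinerary_null in blast)
    from AE_P[OF _ this, of 0] have "AE \<omega> in P. \<not> shadows z (\<lambda>i. \<omega> (int i))" by simp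
    then have "AE \<omega> in P. limit_point \<omega> \<noteq> z"
      using real
    proof eventually_elim
      case (elim \<omega>)
      have "shadows (limit_point \<omega>) (\<lambda>i. \<omega> (int i))"
        unfolding shadows_def using dist_iterates_limit_point_le[OF elim(2)] by blast
      then show ?case using elim(1) by auto
    qed
    then show ?thesis by (subst AE_\<mu>) auto
  qed
  define L where "L = {z. side_form \<alpha> z = 1/2}"
  \<comment> \<open>the points of the fold line that return to it\<close>
  define R where "R = {z \<in> L. \<exists>n>0. (G ^^ n) z \<in> L}"
  have L: "L \<in> sets borel"
  proof -
    have "closed L" unfolding L_def
      using continuous_closed_vimage[of "{1/2}" "side_form \<alpha>"] continuous_side_form
      by (auto simp: vimage_def continuous_on_eq_continuous_at)
    then show ?thesis by simp
  qed
  have R: "countable R" using countable_returns by (simp add: R_def L_def)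
  then have R_sets: "R \<in> sets borel" by (rule sets.countable[rotated]) auto
  have AE_R: "AE z in \<mu>. z \<notin> R"
  proof -
    have "AE z in \<mu>. \<forall>x\<in>R. z \<noteq> x"
      using no_atom by (subst AE_ball_countable[OF R]) auto
    then show ?thesis by eventually_elim auto
  qed
  have LR: "\<mu>.prob (L - R) = 0"
  proof -
    \<comment> \<open>Poincare recurrence: the preimages of the non-returning part are disjoint and equally likely.\<close>
    define A where "A n = (G ^^ n) -` (L - R)" for n
    have A: "A n \<in> sets borel" for n
      unfolding A_def by (rule measurable_sets_borel[OF borel_measurable_G_funpow]) (use L R_sets in auto)
    have "\<mu>.prob (A 0) = 0"
    proof (rule \<mu>.prob_eq_0_if_disjoint_and_equal)
      show "range A \<subseteq> \<mu>.events" using A by (auto simp: sets_\<mu>)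
      have disj: "A m \<inter> A n = {}" if "m < n" for m n
      proof (rule equals0I)
        fix z assume "z \<in> A m \<inter> A n"
        then have z: "(G ^^ m) z \<in> L" "(G ^^ m) z \<notin> R" "(G ^^ n) z \<in> L" by (auto simp: A_def)
        have "(G ^^ (n - m)) ((G ^^ m) z) = (G ^^ n) z"
          using that by (simp add: funpow_add[symmetric, THEN fun_cong, simplified])
        then have "(G ^^ m) z \<in> R" using z that unfolding R_def by (auto intro!: exI[of _ "n - m"])
        then show False using z by simp
      qed
      show "disjoint_family A"
        unfolding disjoint_family_on_def
      proof (intro ballI impI)
        fix m n :: nat assume "m \<noteq> n"
        then show "A m \<inter> A n = {}" using disj[of m n] disj[of n m] by (cases m n rule: linorder_cases) auto
      qed
      show "\<mu>.prob (A n) = \<mu>.prob (A 0)" for n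
      proof -
        have "\<mu>.prob (A 0) = measure (distr \<mu> borel (G ^^ n)) (L - R)"
          by (simp add: inv_n A_def)
        also have "\<dots> = \<mu>.prob (A n)"
          using L R_sets by (subst measure_distr) (auto simp: A_def space_\<mu>)
        finally show ?thesis ..
      qed
    qed
    then show ?thesis by (simp add: A_def)
  qed
  have AE_L: "AE z in \<mu>. z \<notin> L"
  proof -
    have "L - R \<in> null_sets \<mu>"
      using LR L R_sets by (auto simp: null_sets_def sets_\<mu> \<mu>.emeasure_eq_measure)
    then have "AE z in \<mu>. z \<notin> L - R" by (rule AE_not_in)
    then show ?thesis using AE_R by eventually_elim auto
  qed
  have off_k: "AE \<omega> in P. (G ^^ k) (limit_point \<omega>) \<notin> L" for k
  proof -
    have m: "(G ^^ k) \<in> borel_measurable \<mu>" by simp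
    \<comment> \<open>By invariance the whole orbit of the limit point avoids the fold line.\<close>
    have pred: "{z \<in> space borel. z \<notin> L} \<in> sets borel" using L by simp
    have "AE z in distr \<mu> borel (G ^^ k). z \<notin> L" unfolding inv_n by (rule AE_L)
    then have "AE z in \<mu>. (G ^^ k) z \<notin> L" by (simp only: AE_distr_iff[OF m pred])
    moreover have "{z. (G ^^ k) z \<notin> L} = (G ^^ k) -` (- L)" by auto
    then have "Measurable.pred borel (\<lambda>z. (G ^^ k) z \<notin> L)"
      using measurable_sets_borel[OF borel_measurable_G_funpow[of k], of "- L"] L by (simp add: pred_def)
    ultimately show ?thesis by (simp only: AE_\<mu>)
  qed
  have off: "AE \<omega> in P. \<forall>k. (G ^^ k) (limit_point \<omega>) \<notin> L"
    unfolding AE_all_countable using off_k by blast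
  have "AE p in M. \<forall>i. itinerary p i = 0 \<or> itinerary p i = 1" by (simp add: itinerary_def)
  from AE_P[OF _ this, of 0] have bits: "AE \<omega> in P. \<forall>i. \<omega> (int i) = 0 \<or> \<omega> (int i) = 1" by simp
  have "distr \<mu> seq_space itinerary = distr P seq_space (\<lambda>\<omega>. itinerary (limit_point \<omega>))"
    unfolding \<mu>_def by (subst distr_distr[OF measurable_itinerary]) (simp_all add: o_def)
  also have "\<dots> = distr P seq_space (\<lambda>\<omega> i. \<omega> (int i - int 0))"
  proof (rule distr_cong_AE)
    show "AE \<omega> in P. itinerary (limit_point \<omega>) = (\<lambda>i. \<omega> (int i - int 0))"
      using real off bits
    proof eventually_elim
      case (elim \<omega>)
      have "upper \<alpha> k (limit_point \<omega>) \<longleftrightarrow> \<omega> (int k) = 1" for k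
      proof -
        note s = limit_point_shift_funpow[OF elim(1), of k]
        have "upper \<alpha> k (limit_point \<omega>) \<longleftrightarrow> upper \<alpha> 0 (limit_point (\<lambda>i. \<omega> (i + int k)))"
          by (simp add: s(2) upper_funpow)
        also have "\<dots> \<longleftrightarrow> \<omega> (int k) = 1"
          using upper_0_limit_point[OF s(1)] elim(2) by (simp add: s(2) L_def)
        finally show ?thesis .
      qed
      then show ?case using elim(3) by (fastforce simp: itinerary_def fun_eq_iff)
    qed
    show "(\<lambda>\<omega>. itinerary (limit_point \<omega>)) \<in> P \<rightarrow>\<^sub>M seq_space"
      by (rule measurable_compose[OF m_lim measurable_itinerary])
  qed (use m_past[of 0] in auto)
  also have "\<dots> = distr M seq_space itinerary" by (simp only: past law_def)
  finally have "distr \<mu> seq_space itinerary = distr M seq_space itinerary" .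
  then show ?thesis using that \<mu>.prob_space_axioms sets_\<mu> \<mu>_sq inv by blast
qed

end

section \<open>Lifting invariant measures of the factor\<close>

text \<open>The integral of any function over a null set vanishes, measurable or not. This keeps the
  measurability of the fiber length \<open>D\<close>, which enters \<^const>\<open>m_D\<close>, out of the argument.\<close>

lemma absolutely_continuous_density_any: "absolutely_continuous M (density M f)"
proof -
  have "emeasure (density M f) A = 0" if A: "A \<in> null_sets M" for A
  proof -
    have "(\<integral>\<^sup>+ x. f x * indicator A x \<partial>M) = (\<integral>\<^sup>+ x. 0 \<partial>M)"
      by (rule nn_integral_cong_AE) (use AE_not_in[OF A] in eventually_elim, simp)
    then show ?thesis by (simp add: density_def emeasure_measure_of_conv)
  qed
  then show ?thesis by (auto simp: absolutely_continuous_def null_sets_def)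
qed

lemma borel_unit_square: "unit_square \<in> sets borel"
  unfolding unit_square_def by (intro borel_closed closed_Times) auto

context steep
begin

text \<open>This identifies the quotient with the set of itineraries.\<close>

lemma proj_eq_iff_itinerary_eq:
  assumes p: "p \<in> unit_square" and q: "q \<in> unit_square"
  shows "proj \<alpha> p = proj \<alpha> q \<longleftrightarrow> itinerary p = itinerary q"
proof -
  have \<alpha>: "0 \<le> \<alpha>" "\<alpha> \<le> 1" using steep less_1 by auto
  have side: "B = (if upper \<alpha> n r then A2 \<alpha> - A1 \<alpha> else A1 \<alpha>)"
    if "r \<in> unit_square" "B \<in> partition_P \<alpha>" "(G ^^ n) r \<in> B" for r B n
    using that G_square[OF that(1), of n]
    by (cases "(G ^^ n) r") (auto simp: partition_P_def A1_def A2_def upper_def side_form_def)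
  obtain B where B: "\<And>n. B n \<in> partition_P \<alpha>"
      "proj \<alpha> p = {r \<in> unit_square. \<forall>n. (G ^^ n) r \<in> B n}"
    using proj_in[OF \<alpha> p] unfolding partition_P_minus_def by blast
  have B_eq: "B n = (if upper \<alpha> n p then A2 \<alpha> - A1 \<alpha> else A1 \<alpha>)" for n
    using proj_in[OF \<alpha> p] B by (intro side) auto
  have "proj \<alpha> p = proj \<alpha> q \<longleftrightarrow> q \<in> proj \<alpha> p"
    using proj_in[OF \<alpha> p] proj_in[OF \<alpha> q] proj_eq[OF \<alpha>] q by metis
  also have "\<dots> \<longleftrightarrow> (\<forall>n. (G ^^ n) q \<in> B n)" using B q by auto
  also have "\<dots> \<longleftrightarrow> (\<forall>n. upper \<alpha> n p = upper \<alpha> n q)"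
  proof (intro iff_allI)
    fix n
    show "(G ^^ n) q \<in> B n \<longleftrightarrow> upper \<alpha> n p = upper \<alpha> n q"
      using G_square[OF q, of n]
      by (cases "(G ^^ n) q") (auto simp: B_eq A1_def A2_def upper_def side_form_def)
  qed
  also have "\<dots> \<longleftrightarrow> itinerary p = itinerary q" by (auto simp: itinerary_def fun_eq_iff)
  finally show ?thesis .
qed

definition fiber_itinerary :: "(real \<times> real) set \<Rightarrow> nat \<Rightarrow> real" where
  "fiber_itinerary C = itinerary (SOME p. p \<in> C)"

lemma fiber_itinerary_proj:
  assumes "p \<in> unit_square"
  shows "fiber_itinerary (proj \<alpha> p) = itinerary p"
proof -
  have \<alpha>: "0 \<le> \<alpha>" "\<alpha> \<le> 1" using steep less_1 by auto
  define q where "q = (SOME p'. p' \<in> proj \<alpha> p)"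
  have q: "q \<in> proj \<alpha> p" unfolding q_def by (rule someI[of _ p]) (use proj_in[OF \<alpha> assms] in simp)
  have "q \<in> unit_square" using q proj_in[OF \<alpha> assms] unfolding partition_P_minus_def by blast
  then have "proj \<alpha> q = proj \<alpha> p" using q proj_in[OF \<alpha> assms] by (intro proj_eq[OF \<alpha>]) auto
  then show ?thesis
    using proj_eq_iff_itinerary_eq[OF \<open>q \<in> unit_square\<close> assms] by (simp add: fiber_itinerary_def q_def)
qed

text \<open>The quotient \<open>\<sigma>\<close>-algebra contains every set whose preimage in the square is Borel.\<close>

lemma measurable_fiber_itinerary: "fiber_itinerary \<in> quotient_space \<alpha> \<rightarrow>\<^sub>M seq_space"
proof (rule measurableI)
  have \<alpha>: "0 \<le> \<alpha>" "\<alpha> \<le> 1" using steep less_1 by auto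
  fix A :: "(nat \<Rightarrow> real) set" assume A: "A \<in> sets seq_space"
  have "proj \<alpha> -` (fiber_itinerary -` A \<inter> space (quotient_space \<alpha>)) \<inter> unit_square = itinerary -` A \<inter> unit_square"
    using proj_in[OF \<alpha>] by (auto simp: space_quotient_space fiber_itinerary_proj)
  moreover have "itinerary -` A \<in> sets borel" using measurable_sets[OF measurable_itinerary A] by simp
  ultimately show "fiber_itinerary -` A \<inter> space (quotient_space \<alpha>) \<in> sets (quotient_space \<alpha>)"
    using borel_unit_square by (auto simp: sets_quotient_space[OF \<alpha>] space_quotient_space)
qed (simp add: space_PiM)

lemma restrict_invariant:
  assumes \<mu>: "sets \<mu> = sets borel" "AE z in \<mu>. z \<in> unit_square" "distr \<mu> borel G = \<mu>"
  shows "invariant_measure G (restrict_space \<mu> unit_square)"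
proof -
  have [measurable_cong]: "sets \<mu> = sets borel" by fact
  have space: "space \<mu> = UNIV" using sets_eq_imp_space_eq[OF \<mu>(1)] by simp
  have sq: "unit_square \<in> sets \<mu>" by (simp add: \<mu>(1) borel_unit_square)
  let ?N = "restrict_space \<mu> unit_square"
  have m: "G \<in> ?N \<rightarrow>\<^sub>M ?N"
    by (rule measurable_restrict_space3) (use G_square[of _ 1] in auto)
  have "distr ?N ?N G = ?N"
  proof (rule measure_eqI)
    fix A assume "A \<in> sets (distr ?N ?N G)"
    then have A: "A \<subseteq> unit_square" "A \<in> sets borel" "A \<in> sets ?N"
      using sq by (auto simp: sets_restrict_space_iff \<mu>(1))
    have GA: "G -` A \<in> sets \<mu>" using measurable_sets_borel[OF borel_measurable_G A(2)] by (simp add: \<mu>(1))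
    have "emeasure (distr ?N ?N G) A = emeasure ?N (G -` A \<inter> space ?N)"
      using m A(3) by (rule emeasure_distr)
    also have "\<dots> = emeasure \<mu> (G -` A \<inter> unit_square)"
      using sq by (subst emeasure_restrict_space) (auto simp: space_restrict_space space)
    also have "\<dots> = emeasure \<mu> (G -` A)"
      by (rule emeasure_eq_AE) (use \<mu>(2) GA sq in auto)
    also have "\<dots> = emeasure (distr \<mu> borel G) A"
      using A(2) by (subst emeasure_distr) (auto simp: space)
    also have "\<dots> = emeasure ?N A"
      using A sq by (subst emeasure_restrict_space) (auto simp: \<mu>(3))
    finally show "emeasure (distr ?N ?N G) A = emeasure ?N A" .
  qed simp
  with m show ?thesis by (simp add: invariant_measure_def)
qed

text \<open>If \<open>\<kappa>\<close> has density \<open>g\<close> with respect to the projected Lebesgue measure, then \<open>g \<circ> \<pi>\<close> times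
  Lebesgue measure lies over \<open>\<kappa>\<close>. The last conclusion transports laws of functions that are constant
  on fibers from the square to the quotient.\<close>

lemma absolutely_continuous_lift:
  assumes "prob_space \<kappa>" and sets_\<kappa>: "sets \<kappa> = sets (quotient_space \<alpha>)"
    and ac: "absolutely_continuous (m_bar \<alpha>) \<kappa>"
  obtains M where "prob_space M" "sets M = sets borel" "AE p in M. p \<in> unit_square"
    "absolutely_continuous lborel M"
    "\<And>A. A \<in> sets (quotient_space \<alpha>) \<Longrightarrow> emeasure \<kappa> A = emeasure M (proj \<alpha> -` A \<inter> unit_square)"
    "\<And>(N :: 'x measure) f h. f \<in> borel \<rightarrow>\<^sub>M N \<Longrightarrow> h \<in> quotient_space \<alpha> \<rightarrow>\<^sub>M N \<Longrightarrow>
      (\<And>p. p \<in> unit_square \<Longrightarrow> f p = h (proj \<alpha> p)) \<Longrightarrow> distr M N f = distr \<kappa> N h"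
proof -
  have \<alpha>: "0 \<le> \<alpha>" "\<alpha> \<le> 1" using steep less_1 by auto
  interpret \<kappa>: prob_space \<kappa> by fact
  define \<nu> where "\<nu> = restrict_space (lborel :: (real \<times> real) measure) unit_square"
  have sets_\<nu>: "sets \<nu> = sets (restrict_space borel unit_square)"
    unfolding \<nu>_def by (rule sets_restrict_space_cong) simp
  have space_\<nu>: "space \<nu> = unit_square" by (simp add: \<nu>_def space_restrict_space)
  have m_proj: "proj \<alpha> \<in> \<nu> \<rightarrow>\<^sub>M quotient_space \<alpha>"
    using proj_measurable[OF \<alpha>] by (simp add: measurable_cong_sets[OF sets_\<nu> refl])
  have m_bar: "m_bar \<alpha> = distr \<nu> (quotient_space \<alpha>) (proj \<alpha>)" by (simp add: m_bar_def \<nu>_def)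
  have "emeasure \<nu> (space \<nu>) = emeasure lborel (unit_square :: (real \<times> real) set)"
    unfolding space_\<nu> unfolding \<nu>_def using borel_unit_square by (subst emeasure_restrict_space) auto
  also have "\<dots> < \<infinity>"
    unfolding unit_square_def by (rule emeasure_bounded_finite) (intro bounded_Times bounded_closed_interval)
  finally have "finite_measure \<nu>" by (intro finite_measureI) auto
  then interpret m_bar: finite_measure "m_bar \<alpha>"
    unfolding m_bar using m_proj by (rule finite_measure.finite_measure_distr)
  have "sets \<kappa> = sets (m_bar \<alpha>)" by (simp add: sets_\<kappa> m_bar)
  from m_bar.Radon_Nikodym[OF ac this] obtain g where
    g: "g \<in> borel_measurable (quotient_space \<alpha>)" "density (m_bar \<alpha>) g = \<kappa>"
    by (auto simp: m_bar)
  define \<mu>0 where "\<mu>0 = density \<nu> (\<lambda>p. g (proj \<alpha> p))"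
  have gp: "(\<lambda>p. g (proj \<alpha> p)) \<in> borel_measurable \<nu>" using measurable_compose[OF m_proj g(1)] .
  have sets_\<mu>0: "sets \<mu>0 = sets \<nu>" by (simp add: \<mu>0_def)
  have space_\<mu>0: "space \<mu>0 = unit_square" by (simp add: \<mu>0_def space_\<nu>)
  have m_proj0: "proj \<alpha> \<in> \<mu>0 \<rightarrow>\<^sub>M quotient_space \<alpha>"
    using m_proj by (simp add: measurable_cong_sets[OF sets_\<mu>0 refl])
  have push: "distr \<mu>0 (quotient_space \<alpha>) (proj \<alpha>) = \<kappa>"
    using density_distr[OF g(1) m_proj] g(2) by (simp add: m_bar \<mu>0_def)
  have id: "(\<lambda>p. p) \<in> \<mu>0 \<rightarrow>\<^sub>M borel"
    by (simp add: measurable_cong_sets[OF trans[OF sets_\<mu>0 sets_\<nu>] refl] measurable_restrict_space1)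
  define M where "M = distr \<mu>0 borel (\<lambda>p. p)"
  have sets_M: "sets M = sets borel" by (simp add: M_def)
  have M_eq: "emeasure M A = emeasure \<mu>0 (A \<inter> unit_square)" if "A \<in> sets borel" for A
    unfolding M_def using that by (subst emeasure_distr[OF id]) (auto simp: space_\<mu>0)
  have "prob_space (distr \<mu>0 (quotient_space \<alpha>) (proj \<alpha>))" unfolding push by fact
  then have prob0: "prob_space \<mu>0" by (rule prob_space_distrD[OF m_proj0])
  show ?thesis
  proof (rule that)
    show "prob_space M" unfolding M_def by (rule prob_space.prob_space_distr[OF prob0 id])
    show "sets M = sets borel" by (rule sets_M)
    show "AE p in M. p \<in> unit_square"
      unfolding M_def using borel_unit_square AE_space[of \<mu>0]
      by (subst AE_distr_iff[OF id]) (auto simp: space_\<mu>0)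
    show "absolutely_continuous lborel M"
      unfolding absolutely_continuous_def
    proof
      fix N :: "(real \<times> real) set" assume N: "N \<in> null_sets lborel"
      then have "N \<inter> unit_square \<in> null_sets lborel"
        using borel_unit_square by (intro null_set_Int2) auto
      then have "N \<inter> unit_square \<in> null_sets \<nu>"
        unfolding \<nu>_def using borel_unit_square by (subst null_sets_restrict_space) auto
      then have "N \<inter> unit_square \<in> null_sets \<mu>0"
        using absolutely_continuous_density_any[of \<nu> "\<lambda>p. g (proj \<alpha> p)"]
        unfolding absolutely_continuous_def \<mu>0_def by blast
      with N show "N \<in> null_sets M" by (auto simp: null_sets_def sets_M M_eq)
    qed
    show "emeasure \<kappa> A = emeasure M (proj \<alpha> -` A \<inter> unit_square)" if A: "A \<in> sets (quotient_space \<alpha>)" for A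
    proof -
      have "emeasure \<kappa> A = emeasure \<mu>0 (proj \<alpha> -` A \<inter> unit_square)"
        unfolding push[symmetric] using A by (subst emeasure_distr[OF m_proj0]) (auto simp: space_\<mu>0)
      also have "\<dots> = emeasure M (proj \<alpha> -` A \<inter> unit_square)"
        using A by (subst M_eq) (auto simp: sets_quotient_space[OF \<alpha>])
      finally show ?thesis .
    qed
    show "distr M N f = distr \<kappa> N h" if "f \<in> borel \<rightarrow>\<^sub>M N" "h \<in> quotient_space \<alpha> \<rightarrow>\<^sub>M N"
      and eq: "\<And>p. p \<in> unit_square \<Longrightarrow> f p = h (proj \<alpha> p)" for N :: "'x measure" and f h
    proof -
      have "distr M N f = distr \<mu>0 N f"
        unfolding M_def by (subst distr_distr[OF that(1) id]) (simp add: o_def)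
      also have "\<dots> = distr \<mu>0 N (\<lambda>p. h (proj \<alpha> p))"
        by (rule distr_cong) (simp_all add: space_\<mu>0 eq)
      also have "\<dots> = distr \<kappa> N h"
        unfolding push[symmetric] by (subst distr_distr[OF that(2) m_proj0]) (simp add: o_def)
      finally show ?thesis .
    qed
  qed
qed

text \<open>The absolutely continuous lift \<open>M\<close> of \<open>\<kappa>\<close> has a stationary itinerary, because the itinerary is a
  function on the quotient and \<open>\<kappa>\<close> is invariant there. The invariant measure \<open>\<mu>\<close> built from it has the same
  itinerary law, hence agrees with \<open>M\<close> on all Borel unions of fibers, which are the preimages of the
  measurable sets of the quotient.\<close>

lemma invariant_lift:
  assumes "prob_space \<kappa>" and sets_\<kappa>: "sets \<kappa> = sets (quotient_space \<alpha>)"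
    and inv: "invariant_measure (factor_map \<alpha>) \<kappa>"
    and ac: "absolutely_continuous (m_bar \<alpha>) \<kappa>"
  shows "\<exists>\<mu>. sets \<mu> = sets (restrict_space borel unit_square) \<and> invariant_measure G \<mu> \<and>
    distr \<mu> (quotient_space \<alpha>) (proj \<alpha>) = \<kappa>"
proof -
  have \<alpha>: "0 \<le> \<alpha>" "\<alpha> \<le> 1" using steep less_1 by auto
  obtain M where M: "prob_space M" "sets M = sets borel" "AE p in M. p \<in> unit_square"
      "absolutely_continuous lborel M"
    and \<kappa>_eq: "\<And>A. A \<in> sets (quotient_space \<alpha>) \<Longrightarrow> emeasure \<kappa> A = emeasure M (proj \<alpha> -` A \<inter> unit_square)"
    and push: "\<And>(N :: (nat \<Rightarrow> real) measure) f h. f \<in> borel \<rightarrow>\<^sub>M N \<Longrightarrow> h \<in> quotient_space \<alpha> \<rightarrow>\<^sub>M N \<Longrightarrow>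
      (\<And>p. p \<in> unit_square \<Longrightarrow> f p = h (proj \<alpha> p)) \<Longrightarrow> distr M N f = distr \<kappa> N h"
    using absolutely_continuous_lift[OF assms(1) sets_\<kappa> ac] by metis
  have T: "factor_map \<alpha> \<in> \<kappa> \<rightarrow>\<^sub>M \<kappa>" "distr \<kappa> \<kappa> (factor_map \<alpha>) = \<kappa>"
    using inv by (auto simp: invariant_measure_def)
  have T': "factor_map \<alpha> \<in> quotient_space \<alpha> \<rightarrow>\<^sub>M quotient_space \<alpha>"
    using T(1) by (simp add: measurable_cong_sets[OF sets_\<kappa> sets_\<kappa>])
  have fc: "fiber_itinerary \<in> \<kappa> \<rightarrow>\<^sub>M seq_space"
    using measurable_fiber_itinerary by (simp add: measurable_cong_sets[OF sets_\<kappa> refl])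
  have "distr M seq_space (\<lambda>p. itinerary (G p)) = distr \<kappa> seq_space (\<lambda>C. fiber_itinerary (factor_map \<alpha> C))"
  proof (rule push)
    show "(\<lambda>C. fiber_itinerary (factor_map \<alpha> C)) \<in> quotient_space \<alpha> \<rightarrow>\<^sub>M seq_space"
      by (rule measurable_compose[OF T' measurable_fiber_itinerary])
    show "itinerary (G p) = fiber_itinerary (factor_map \<alpha> (proj \<alpha> p))" if "p \<in> unit_square" for p
      using that G_square[OF that, of 1] by (simp add: factor_map_proj[OF \<alpha>] fiber_itinerary_proj)
  qed measurable
  also have "\<dots> = distr (distr \<kappa> \<kappa> (factor_map \<alpha>)) seq_space fiber_itinerary"
    by (subst distr_distr[OF fc T(1)]) (simp add: o_def)
  also have "\<dots> = distr \<kappa> seq_space fiber_itinerary" by (simp add: T(2))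
  also have "\<dots> = distr M seq_space itinerary"
    by (rule push[symmetric]) (simp_all add: measurable_fiber_itinerary fiber_itinerary_proj)
  finally have st: "distr M seq_space (\<lambda>p. itinerary (G p)) = distr M seq_space itinerary" .
  interpret stationary_itinerary \<alpha> M
    by (intro stationary_itinerary.intro steep_axioms stationary_itinerary_axioms.intro M st)
  obtain \<mu> where \<mu>: "prob_space \<mu>" "sets \<mu> = sets borel" "AE z in \<mu>. z \<in> unit_square"
      "distr \<mu> borel G = \<mu>" and law: "distr \<mu> seq_space itinerary = distr M seq_space itinerary"
    by (rule invariant_lift_exists)
  interpret \<mu>: prob_space \<mu> by fact
  have itinerary_borel: "itinerary \<in> borel_measurable borel"
    using measurable_itinerary by (simp add: measurable_cong_sets[OF refl sets_PiM_equal_borel])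
  have law': "distr \<mu> borel itinerary = distr M borel itinerary"
    using law distr_cong[OF refl sets_PiM_equal_borel refl, of \<mu> itinerary]
      distr_cong[OF refl sets_PiM_equal_borel refl, of M itinerary] by simp
  have space: "space \<mu> = UNIV" "space M = UNIV"
    using sets_eq_imp_space_eq[OF \<mu>(2)] sets_eq_imp_space_eq[OF M(2)] by auto
  have off: "emeasure N (- unit_square) = 0" if "sets N = sets borel" "AE z in N. z \<in> unit_square" for N
  proof -
    have "AE z in N. z \<notin> - unit_square" using that(2) by simp
    then show ?thesis using that borel_unit_square by (subst (asm) AE_iff_null_sets[symmetric]) auto
  qed
  have eq: "emeasure \<mu> S = emeasure M S"
    if S: "S \<in> sets borel" and sat: "\<And>p q. p \<in> S \<Longrightarrow> q \<in> unit_square \<Longrightarrow> itinerary p = itinerary q \<Longrightarrow> q \<in> S" for S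
  proof (rule antisym)
    show "emeasure \<mu> S \<le> emeasure M S"
      by (rule saturated_measure_le[OF \<mu>(2) _ M(2) itinerary_borel law' S borel_unit_square off[OF M(2,3)] sat])
        unfold_locales
    show "emeasure M S \<le> emeasure \<mu> S"
      by (rule saturated_measure_le[OF M(2) _ \<mu>(2) itinerary_borel law'[symmetric] S borel_unit_square off[OF \<mu>(2,3)] sat])
        unfold_locales
  qed
  let ?N = "restrict_space \<mu> unit_square"
  have sets_N: "sets ?N = sets (restrict_space borel unit_square)"
    by (rule sets_restrict_space_cong) (rule \<mu>(2))
  have m_proj: "proj \<alpha> \<in> ?N \<rightarrow>\<^sub>M quotient_space \<alpha>"
    using proj_measurable[OF \<alpha>] by (simp add: measurable_cong_sets[OF sets_N refl])
  have "distr ?N (quotient_space \<alpha>) (proj \<alpha>) = \<kappa>"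
  proof (rule measure_eqI)
    fix A assume "A \<in> sets (distr ?N (quotient_space \<alpha>) (proj \<alpha>))"
    then have A: "A \<in> sets (quotient_space \<alpha>)" by simp
    let ?S = "proj \<alpha> -` A \<inter> unit_square"
    have "emeasure (distr ?N (quotient_space \<alpha>) (proj \<alpha>)) A = emeasure ?N ?S"
      using A by (subst emeasure_distr[OF m_proj]) (auto simp: space_restrict_space space)
    also have "\<dots> = emeasure \<mu> ?S"
      using borel_unit_square by (subst emeasure_restrict_space) (auto simp: \<mu>(2) space)
    also have "\<dots> = emeasure M ?S"
    proof (rule eq)
      show "?S \<in> sets borel" using A by (simp add: sets_quotient_space[OF \<alpha>])
      show "q \<in> ?S" if "p \<in> ?S" "q \<in> unit_square" "itinerary p = itinerary q" for p q
        using that proj_eq_iff_itinerary_eq[of p q] by simp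
    qed
    also have "\<dots> = emeasure \<kappa> A" using \<kappa>_eq[OF A] by simp
    finally show "emeasure (distr ?N (quotient_space \<alpha>) (proj \<alpha>)) A = emeasure \<kappa> A" .
  qed (simp add: sets_\<kappa>)
  then show ?thesis
    using sets_N restrict_invariant[OF \<mu>(2-4)] by blast
qed

end

theorem corollary4:
  fixes \<alpha> :: real and s :: nat and \<phi> :: "nat \<Rightarrow> (real \<times> real) set \<Rightarrow> real"
  assumes "3/4 < \<alpha>" and "\<alpha> < 1"
    and "\<And>i. i \<in> {1..s} \<Longrightarrow> ergodic_density \<alpha> (\<phi> i)"
    and "\<And>i j. i \<in> {1..s} \<Longrightarrow> j \<in> {1..s} \<Longrightarrow> i \<noteq> j \<Longrightarrow> \<not> (AE x in m_D \<alpha>. \<phi> i x = \<phi> j x)"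
    and "\<And>\<psi>. ergodic_density \<alpha> \<psi> \<Longrightarrow> \<exists>i\<in>{1..s}. AE x in m_D \<alpha>. \<psi> x = \<phi> i x"
  shows "\<exists>\<mu> :: nat \<Rightarrow> (real \<times> real) measure. \<forall>i\<in>{1..s}.
           sets (\<mu> i) = sets (restrict_space borel unit_square) \<and>
           invariant_measure (G_map \<alpha>) (\<mu> i) \<and>
           distr (\<mu> i) (quotient_space \<alpha>) (proj \<alpha>) = density (m_D \<alpha>) (\<lambda>x. ennreal (\<phi> i x))"
proof -
  interpret steep \<alpha> using assms(1,2) by unfold_locales
  have "\<exists>\<mu>. sets \<mu> = sets (restrict_space borel unit_square) \<and> invariant_measure (G_map \<alpha>) \<mu> \<and>
      distr \<mu> (quotient_space \<alpha>) (proj \<alpha>) = density (m_D \<alpha>) (\<lambda>x. ennreal (\<phi> i x))"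
    if "i \<in> {1..s}" for i
  proof (rule invariant_lift)
    show "prob_space (density (m_D \<alpha>) (\<lambda>x. ennreal (\<phi> i x)))"
      "invariant_measure (factor_map \<alpha>) (density (m_D \<alpha>) (\<lambda>x. ennreal (\<phi> i x)))"
      using assms(3)[OF that] by (auto simp: ergodic_density_def ergodic_probability_def)
    show "sets (density (m_D \<alpha>) (\<lambda>x. ennreal (\<phi> i x))) = sets (quotient_space \<alpha>)"
      by (simp add: m_D_def m_bar_def)
    show "absolutely_continuous (m_bar \<alpha>) (density (m_D \<alpha>) (\<lambda>x. ennreal (\<phi> i x)))"
      using absolutely_continuous_density_any[of "m_bar \<alpha>" "\<lambda>C. 1 / ennreal (diameter C)"]
        absolutely_continuous_density_any[of "m_D \<alpha>" "\<lambda>x. ennreal (\<phi> i x)"]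
      unfolding absolutely_continuous_def m_D_def by blast
  qed
  then show ?thesis by metis
qed

end
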